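(* Suppose $G$ is a graph with a $\kappa$-clique cut $S$. Let $t=|S|$, let $H_1,\ldots,H_m$ denote the $S$-subgraphs of $G$, and for each $i\in\{1,\ldots,m\}$ let $C_i$ be the component of $G-S$ given by $H_i-S$. Then $G$ is ideally connected if and only if all of the following conditions hold: (1) Every $S$-subgraph of $G$ is an ideally connected, $t$-connected graph. (2) Among the subgraphs $C_1,\ldots,C_m$, at most one has a vertex of degree greater than $t$ in $G$. If such a component, say $C_j$, exists, then $\deg_{H_j}(u)\le \deg_{H_j}(s)<\deg_G(s)$ for every $u\in V(H_j)\setminus S$ and $s\in S$. (3) For distinct vertices $s_1,s_2\in S$ with $\deg_G(s_1)\le\deg_G(s_2)$, we have $\deg_{H_i}(s_1)\le\deg_{H_i}(s_2)$ for every $i\in\{1,\ldots,m\}$.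
   Context: All graphs are finite and simple. For distinct vertices $u,v$ of a graph $G$, $\kappa_G(u,v)$ denotes the maximum number of (pairwise distinct) internally disjoint $u$-$v$ paths in $G$ (the edge $uv$, if present, counts as one path). $G$ is ideally connected if $\kappa_G(u,v)=\min\{\deg_G(u),\deg_G(v)\}$ for every pair of distinct vertices $u,v$. The vertex connectivity $\kappa(G)$ is the minimum size of a vertex set whose removal disconnects $G$, with $\kappa(G)=|V(G)|-1$ if $G$ is complete; $G$ is $t$-connected if $\kappa(G)\ge t$. A $\kappa$-clique cut of a graph $G$, where $G$ is connected and not complete, is a vertex cutset $S$ (i.e. $G-S$ is disconnected) whose vertices are pairwise adjacent and with $|S|=\kappa(G)$. If $C_1,\ldots,C_m$ are the components of $G-S$, the $S$-subgraphs of $G$ are the induced subgraphs $G[V(C_1)\cup S],\ldots,G[V(C_m)\cup S]$. *)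

theory Defs
  imports "Graph_Theory.Graph_Theory"
begin

text \<open>
  Finite simple graphs are given by the locale \<^locale>\<open>graph\<close>: finite symmetric digraphs without
  loops and parallel arcs, an undirected edge being a pair of opposite arcs. The degree of a vertex
  is therefore its out-degree.
\<close>

abbreviation deg :: "('a, 'b) pre_digraph \<Rightarrow> 'a \<Rightarrow> nat" where
  "deg \<equiv> out_degree"

definition del_verts :: "('a, 'b) pre_digraph \<Rightarrow> 'a set \<Rightarrow> ('a, 'b) pre_digraph" where
  "del_verts G S = G \<restriction> (verts G - S)"

definition components :: "('a, 'b) pre_digraph \<Rightarrow> ('a, 'b) pre_digraph set" where
  "components G = {C. pre_digraph.max_subgraph G Digraph_Component.connected C}"

definition complete :: "('a, 'b) pre_digraph \<Rightarrow> bool" where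
  "complete G \<longleftrightarrow> complete_digraph (card (verts G)) G"

definition paths_between :: "('a, 'b) pre_digraph \<Rightarrow> 'a \<Rightarrow> 'a \<Rightarrow> 'a vwalk set" where
  "paths_between G u v = {p. vpath p G \<and> hd p = u \<and> last p = v}"

definition internal_verts :: "'a vwalk \<Rightarrow> 'a set" where
  "internal_verts p = set (butlast (tl p))"

definition internally_disjoint :: "'a vwalk \<Rightarrow> 'a vwalk \<Rightarrow> bool" where
  "internally_disjoint p q \<longleftrightarrow> internal_verts p \<inter> internal_verts q = {}"

text \<open>
  \<open>\<kappa>\<^sub>G(u,v)\<close>, for distinct vertices of a finite graph. An edge \<open>uv\<close> contributes the single path
  \<open>[u, v]\<close>, which has no internal vertices.
\<close>

definition local_connectivity :: "('a, 'b) pre_digraph \<Rightarrow> 'a \<Rightarrow> 'a \<Rightarrow> nat" where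
  "local_connectivity G u v =
     Max {card P | P. P \<subseteq> paths_between G u v \<and> pairwise internally_disjoint P}"

definition ideally_connected :: "('a, 'b) pre_digraph \<Rightarrow> bool" where
  "ideally_connected G \<longleftrightarrow>
     (\<forall>u\<in>verts G. \<forall>v\<in>verts G. u \<noteq> v \<longrightarrow> local_connectivity G u v = min (deg G u) (deg G v))"

text \<open>
  The library regards the null graph as not connected, so the inclusion below is proper: removing
  all vertices does not count as disconnecting the graph.
\<close>

definition vertex_cutset :: "('a, 'b) pre_digraph \<Rightarrow> 'a set \<Rightarrow> bool" where
  "vertex_cutset G S \<longleftrightarrow> S \<subset> verts G \<and> \<not> Digraph_Component.connected (del_verts G S)"

definition vertex_connectivity :: "('a, 'b) pre_digraph \<Rightarrow> nat" where
  "vertex_connectivity G =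
     (if complete G then card (verts G) - 1 else Min {card S | S. vertex_cutset G S})"

definition t_connected :: "nat \<Rightarrow> ('a, 'b) pre_digraph \<Rightarrow> bool" where
  "t_connected t G \<longleftrightarrow> t \<le> vertex_connectivity G"

definition kappa_clique_cut :: "('a, 'b) pre_digraph \<Rightarrow> 'a set \<Rightarrow> bool" where
  "kappa_clique_cut G S \<longleftrightarrow>
     Digraph_Component.connected G \<and> \<not> complete G \<and> vertex_cutset G S \<and>
     (\<forall>s\<in>S. \<forall>s'\<in>S. s \<noteq> s' \<longrightarrow> s \<rightarrow>\<^bsub>G\<^esub> s') \<and> card S = vertex_connectivity G"

definition S_subgraphs :: "('a, 'b) pre_digraph \<Rightarrow> 'a set \<Rightarrow> ('a, 'b) pre_digraph set" where
  "S_subgraphs G S = (\<lambda>C. G \<restriction> (verts C \<union> S)) ` components (del_verts G S)"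

end

theory Submission
  imports Defs
begin

text \<open>
  Discarding from a path of \<open>G\<close> all vertices outside an \<open>S\<close>-subgraph \<open>H\<close> yields a path of \<open>H\<close>,
  because an excursion outside \<open>H\<close> leaves and returns through two vertices of the clique \<open>S\<close>. So
  internally disjoint paths of \<open>G\<close> with ends in \<open>H\<close> survive in \<open>H\<close>, provided their first edges
  lie in \<open>H\<close>. If \<open>G\<close> is ideally connected, the paths between \<open>s, s' \<in> S\<close> exhaust all edges at the end of
  smaller degree, hence so do those inside each \<open>H\<close>; this gives (1) and (3). Paths between different
  components cross \<open>S\<close>, which gives (2).

  Conversely, a saturated family of paths from \<open>s\<close> to \<open>s'\<close> in \<open>H\<close> uses every edge from \<open>s\<close> to \<open>S\<close>,
  so its paths entering the component \<open>H - S\<close> avoid \<open>S\<close>; the families of different \<open>S\<close>-subgraphs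
  together with the paths \<open>s, w, s'\<close> through \<open>w \<in> S\<close> are therefore internally disjoint. Vertices of
  different components are joined by \<open>card S\<close> paths by Menger's theorem.
\<close>

unbundle no funcset_syntax

section \<open>Menger's theorem\<close>

text \<open>Walks are vertex lists over a bare arc relation, so that \<open>menger\<close> can
  delete one arc at a time by induction on a finite set. A one-element list is a walk from
  \<open>A\<close> to \<open>B\<close> whenever its vertex lies in both.\<close>

definition walk :: "('a \<times> 'a) set \<Rightarrow> 'a set \<Rightarrow> 'a set \<Rightarrow> 'a list \<Rightarrow> bool" where
  "walk E A B p \<longleftrightarrow> p \<noteq> [] \<and> hd p \<in> A \<and> last p \<in> B \<and> set (vwalk_arcs p) \<subseteq> E"

definition separates :: "('a \<times> 'a) set \<Rightarrow> 'a set \<Rightarrow> 'a set \<Rightarrow> 'a set \<Rightarrow> bool" where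
  "separates E A B X \<longleftrightarrow> (\<forall>p. walk E A B p \<longrightarrow> set p \<inter> X \<noteq> {})"

definition linkage :: "('a \<times> 'a) set \<Rightarrow> 'a set \<Rightarrow> 'a set \<Rightarrow> 'a list set \<Rightarrow> bool" where
  "linkage E A B P \<longleftrightarrow> finite P \<and> (\<forall>p\<in>P. walk E A B p \<and> distinct p) \<and>
     (\<forall>p\<in>P. \<forall>q\<in>P. p \<noteq> q \<longrightarrow> set p \<inter> set q = {})"

lemma vwalk_arcs_Cons_append:
  "vwalk_arcs (p @ w # q) = vwalk_arcs (p @ [w]) @ vwalk_arcs (w # q)"
  by (induction p rule: vwalk_arcs.induct) auto

lemma arc_in_snocD: "(x, y) \<in> set (vwalk_arcs (p @ [w])) \<Longrightarrow> x \<in> set p"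
  by (induction p rule: vwalk_arcs.induct) auto

lemma arc_in_ConsD: "(x, y) \<in> set (vwalk_arcs (w # q)) \<Longrightarrow> y \<in> set q"
  by (induction q arbitrary: w) auto

lemma walk_split:
  assumes "walk E A B (p @ w # q)"
  shows "walk E A {w} (p @ [w])" "walk E {w} B (w # q)"
  using assms unfolding walk_def vwalk_arcs_Cons_append[of p w q] by (cases p; auto)+

lemma walk_mono: "walk E A B p \<Longrightarrow> E \<subseteq> E' \<Longrightarrow> A \<subseteq> A' \<Longrightarrow> B \<subseteq> B' \<Longrightarrow> walk E' A' B' p"
  unfolding walk_def by blast

lemma walk_join:
  assumes "walk E A B p" "walk E B' C q" "last p = hd q"
  shows "walk E A C (p @ tl q)"
proof -
  obtain w q' where q: "q = w # q'" using assms by (cases q) (auto simp: walk_def)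
  obtain p' where p: "p = p' @ [w]"
    using assms q by (cases p rule: rev_cases) (auto simp: walk_def)
  show ?thesis using assms unfolding p q walk_def
    by (cases p') (auto simp: vwalk_arcs_Cons_append[of p' w q'] vwalk_arcs_Cons_append[of "_ # _" w q', simplified])
qed

lemma walk_append:
  assumes "walk E A B p" "walk E B' C q" "(last p, hd q) \<in> E"
  shows "walk E A C (p @ q)"
  using assms by (auto simp: walk_def vwalk_arcs_append)

text \<open>Up to its first vertex in \<open>insert x X\<close> a walk cannot use the arc
  \<open>(x, y)\<close>, since it would have visited \<open>x\<close> before. That initial segment
  is thus a walk of \<open>F\<close>, and \<open>Z\<close> meets it.\<close>

lemma separates_bypass_source:
  assumes sep: "separates (insert (x, y) F) A B (insert x X)"
    and Z: "separates F A (insert x X) Z"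
  shows "separates (insert (x, y) F) A B Z"
  unfolding separates_def
proof (intro allI impI)
  fix p assume p: "walk (insert (x, y) F) A B p"
  then obtain a w b where ab: "p = a @ w # b" "w \<in> insert x X" "\<forall>v\<in>set a. v \<notin> insert x X"
    using sep split_list_first_prop[of p "\<lambda>v. v \<in> insert x X"] unfolding separates_def by blast
  have "walk (insert (x, y) F) A {w} (a @ [w])" using walk_split(1) p ab(1) by metis
  moreover have "(x, y) \<notin> set (vwalk_arcs (a @ [w]))" using ab(3) arc_in_snocD by fastforce
  ultimately have "walk F A (insert x X) (a @ [w])" using ab(2) unfolding walk_def by auto
  then have "set (a @ [w]) \<inter> Z \<noteq> {}" using Z unfolding separates_def by blast
  then show "set p \<inter> Z \<noteq> {}" using ab(1) by auto
qed

text \<open>The mirror image: after its last vertex in \<open>insert y X\<close> a walk cannot use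
  \<open>(x, y)\<close>, since it would visit \<open>y\<close> again.\<close>

lemma separates_bypass_target:
  assumes sep: "separates (insert (x, y) F) A B (insert y X)"
    and Z: "separates F (insert y X) B Z"
  shows "separates (insert (x, y) F) A B Z"
  unfolding separates_def
proof (intro allI impI)
  fix p assume p: "walk (insert (x, y) F) A B p"
  then obtain a w b where ab: "p = a @ w # b" "w \<in> insert y X" "\<forall>v\<in>set b. v \<notin> insert y X"
    using sep split_list_last_prop[of p "\<lambda>v. v \<in> insert y X"] unfolding separates_def by blast
  have "walk (insert (x, y) F) {w} B (w # b)" using walk_split(2) p ab(1) by metis
  moreover have "(x, y) \<notin> set (vwalk_arcs (w # b))" using ab(3) arc_in_ConsD by fastforce
  ultimately have "walk F (insert y X) B (w # b)" using ab(2) unfolding walk_def by auto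
  then have "set (w # b) \<inter> Z \<noteq> {}" using Z unfolding separates_def by blast
  then show "set p \<inter> Z \<noteq> {}" using ab(1) by auto
qed

text \<open>A walk that uses the new arc contains both of its ends.\<close>

lemma separates_insert_end:
  assumes "separates F A B X" "v = x \<or> v = y"
  shows "separates (insert (x, y) F) A B (insert v X)"
  unfolding separates_def
proof (intro allI impI notI)
  fix p assume p: "walk (insert (x, y) F) A B p" "set p \<inter> insert v X = {}"
  then have "(x, y) \<notin> set (vwalk_arcs p)" using arcs_in_vwalk_arcs[of "(x, y)" p] assms(2) by auto
  then have "walk F A B p" using p unfolding walk_def by auto
  then show False using assms(1) p(2) unfolding separates_def by blast
qed

text \<open>Disjoint paths have different ends, so equal cardinalities make the end map a bijection
  onto \<open>T\<close>. Indexing the paths by their ends prepares the concatenation of two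
  linkages; each path meets \<open>T\<close> only in its own end because the other vertices of
  \<open>T\<close> lie on other paths.\<close>

lemma linkage_ends:
  assumes "linkage E A B P" "f = hd \<or> f = last" "f ` P \<subseteq> T" "finite T" "card P = card T"
  obtains p where "\<And>z. z \<in> T \<Longrightarrow> p z \<in> P" "\<And>z. z \<in> T \<Longrightarrow> f (p z) = z"
    "\<And>z. z \<in> T \<Longrightarrow> set (p z) \<inter> T = {z}"
    "\<And>z z'. z \<in> T \<Longrightarrow> z' \<in> T \<Longrightarrow> z \<noteq> z' \<Longrightarrow> set (p z) \<inter> set (p z') = {}"
proof -
  have fin: "f p \<in> set p" if "p \<in> P" for p
    using assms(1,2) that unfolding linkage_def walk_def by auto
  have disj: "set p \<inter> set q = {}" if "p \<in> P" "q \<in> P" "p \<noteq> q" for p q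
    using assms(1) that unfolding linkage_def by blast
  have inj: "inj_on f P"
  proof (rule inj_onI)
    fix p q assume "p \<in> P" "q \<in> P" "f p = f q"
    then show "p = q" using fin[of p] fin[of q] disj[of p q] by auto
  qed
  then have im: "f ` P = T"
    using assms(3-5) card_image card_subset_eq by metis
  define p where "p = inv_into P f"
  have 1: "p z \<in> P" "f (p z) = z" if "z \<in> T" for z
    using that im unfolding p_def by (auto intro: inv_into_into f_inv_into_f)
  have 2: "set (p z) \<inter> set (p z') = {}" if "z \<in> T" "z' \<in> T" "z \<noteq> z'" for z z'
    using 1 that disj by metis
  have 3: "z \<in> set (p z)" if "z \<in> T" for z using fin 1 that by metis
  have "set (p z) \<inter> T = {z}" if "z \<in> T" for z using 2 3 that by blast
  then show thesis using that 1 2 by blast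
qed

text \<open>Goering's induction: deleting an arc \<open>(x, y)\<close> either keeps all separators large, or leaves a
  separator \<open>X\<close> with \<open>k - 1\<close> vertices, and then linkages from \<open>A\<close> to \<open>X + x\<close> and from \<open>X + y\<close>
  to \<open>B\<close> meet only in \<open>X\<close> and can be concatenated.\<close>

theorem menger:
  assumes "finite E" "finite A" "finite B"
    and "\<And>X. finite X \<Longrightarrow> separates E A B X \<Longrightarrow> k \<le> card X"
  shows "\<exists>P. linkage E A B P \<and> card P = k"
  using assms
proof (induction E arbitrary: A B k rule: finite_induct)
  case empty
  \<comment> \<open>Without arcs every walk is a single vertex of \<open>A \<inter> B\<close>, so
    the linkage consists of one-vertex paths.\<close>
  have "separates {} A B (A \<inter> B)" unfolding separates_def walk_def
    by (metis IntI disjoint_iff empty_iff last_ConsL list.sel(1) list.set_intros(1) set_empty subset_empty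
        vwalk_arcs.elims list.discI)
  then obtain T where T: "T \<subseteq> A \<inter> B" "card T = k" "finite T"
    using empty obtain_subset_with_card_n by (metis finite_Int finite_subset)
  have "linkage {} A B ((\<lambda>x. [x]) ` T)" "card ((\<lambda>x. [x]) ` T) = k"
    using T by (auto simp: linkage_def walk_def card_image inj_on_def)
  then show ?case by blast
next
  case (insert e F)
  obtain x y where e: "e = (x, y)" by fastforce
  let ?E = "insert (x, y) F"
  have min: "k \<le> card X" if "finite X" "separates ?E A B X" for X
    using insert.prems(3) that e by blast
  show ?case
  proof (cases "\<forall>X. finite X \<longrightarrow> separates F A B X \<longrightarrow> k \<le> card X")
    case True
    have "\<exists>P. linkage F A B P \<and> card P = k"
      by (rule insert.IH) (use insert.prems True in auto)
    then obtain P where P: "linkage F A B P" "card P = k" by blast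
    have "walk (insert e F) A B p" if "p \<in> P" for p
      using P(1) that walk_mono[of F A B p "insert e F" A B] unfolding linkage_def by blast
    with P have "linkage (insert e F) A B P" "card P = k" by (simp_all add: linkage_def)
    then show ?thesis by blast
  next
    case False
    then obtain X where X: "finite X" "separates F A B X" "card X < k" by auto
    let ?P = "insert x X" and ?Q = "insert y X"
    have sepP: "separates ?E A B ?P" and sepQ: "separates ?E A B ?Q"
      using separates_insert_end[OF X(2)] by blast+
    \<comment> \<open>Since \<open>card X < k\<close>, both bounds force
      \<open>card X = k - 1\<close> and put \<open>x\<close> and \<open>y\<close> outside
      \<open>X\<close>.\<close>
    have "k \<le> card ?P" "k \<le> card ?Q" using min sepP sepQ X(1) by simp_all
    then have xy: "x \<notin> X" "y \<notin> X" and cardP: "card ?P = k" and cardQ: "card ?Q = k"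
      using X(1,3) by (auto simp: card_insert_if split: if_splits)
    have "\<exists>P. linkage F A ?P P \<and> card P = k"
      by (rule insert.IH) (use insert.prems X(1) min separates_bypass_source[OF sepP] in auto)
    then obtain P1 where P1: "linkage F A ?P P1" "card P1 = k" by blast
    have "\<exists>P. linkage F ?Q B P \<and> card P = k"
      by (rule insert.IH) (use insert.prems X(1) min separates_bypass_target[OF sepQ] in auto)
    then obtain P2 where P2: "linkage F ?Q B P2" "card P2 = k" by blast
    obtain p where p: "\<And>z. z \<in> ?P \<Longrightarrow> p z \<in> P1" "\<And>z. z \<in> ?P \<Longrightarrow> last (p z) = z"
      "\<And>z. z \<in> ?P \<Longrightarrow> set (p z) \<inter> ?P = {z}"
      "\<And>z z'. z \<in> ?P \<Longrightarrow> z' \<in> ?P \<Longrightarrow> z \<noteq> z' \<Longrightarrow> set (p z) \<inter> set (p z') = {}"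
      using linkage_ends[OF P1(1), of last ?P] P1 cardP X(1) unfolding linkage_def walk_def by auto
    obtain q where q: "\<And>z. z \<in> ?Q \<Longrightarrow> q z \<in> P2" "\<And>z. z \<in> ?Q \<Longrightarrow> hd (q z) = z"
      "\<And>z. z \<in> ?Q \<Longrightarrow> set (q z) \<inter> ?Q = {z}"
      "\<And>z z'. z \<in> ?Q \<Longrightarrow> z' \<in> ?Q \<Longrightarrow> z \<noteq> z' \<Longrightarrow> set (q z) \<inter> set (q z') = {}"
      using linkage_ends[OF P2(1), of hd ?Q] P2 cardQ X(1) unfolding linkage_def walk_def by auto
    have pw: "walk F A ?P (p z)" "distinct (p z)" if "z \<in> ?P" for z
      using p(1)[OF that] P1(1) unfolding linkage_def by auto
    have qw: "walk F ?Q B (q z)" "distinct (q z)" if "z \<in> ?Q" for z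
      using q(1)[OF that] P2(1) unfolding linkage_def by auto
    \<comment> \<open>If the two paths met at \<open>v\<close> outside \<open>X\<close>, splicing
      them at \<open>v\<close> would give an \<open>F\<close>-walk from \<open>A\<close> to
      \<open>B\<close>, hence a vertex of \<open>X\<close> before \<open>v\<close> on the first path
      or after \<open>v\<close> on the second. But \<open>X\<close> is met only in the last vertex
      of the first path and in the first vertex of the second.\<close>
    have meet: "v \<in> X \<and> v = z \<and> v = w"
      if zw: "z \<in> ?P" "w \<in> ?Q" and v: "v \<in> set (p z)" "v \<in> set (q w)" for z w v
    proof -
      have "v \<in> X"
      proof (rule ccontr)
        assume nX: "v \<notin> X"
        obtain a b where ab: "p z = a @ v # b" using v(1) split_list by metis
        obtain c d where cd: "q w = c @ v # d" using v(2) split_list by metis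
        have "walk F A {v} (a @ [v])" using walk_split(1) pw(1)[OF zw(1)] ab by metis
        moreover have "walk F {v} B (v # d)" using walk_split(2) qw(1)[OF zw(2)] cd by metis
        ultimately have "walk F A B ((a @ [v]) @ tl (v # d))" by (rule walk_join) simp
        then obtain s where s: "s \<in> set ((a @ [v]) @ d)" "s \<in> X"
          using X(2) unfolding separates_def by fastforce
        show False
        proof (cases "s \<in> set a")
          case True
          then have "s = z" using p(3)[OF zw(1)] s(2) ab by auto
          then have "s \<in> set (v # b)" using p(2)[OF zw(1)] ab by (metis last_appendR last_in_set list.discI)
          then show False using True pw(2)[OF zw(1)] ab by auto
        next
          case False
          then have sd: "s \<in> set d" using s nX by auto
          then have "s = w" using q(3)[OF zw(2)] s(2) cd by auto
          then have "s \<in> set (c @ [v])" using q(2)[OF zw(2)] cd by (cases c) auto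
          then show False using sd qw(2)[OF zw(2)] cd by auto
        qed
      qed
      then show ?thesis using p(3)[OF zw(1)] q(3)[OF zw(2)] v by auto
    qed
    \<comment> \<open>\<open>s\<close> matches the path ending in \<open>z\<close> with the path
      that continues it: through the deleted arc if \<open>z = x\<close>, and otherwise at the
      shared vertex \<open>z\<close>, whose second copy \<open>tl\<close> removes.\<close>
    define s where "s z = (if z = x then y else z)" for z
    define r where "r z = (if z = x then p x @ q y else p z @ tl (q z))" for z
    have s: "s z \<in> ?Q" if "z \<in> ?P" for z using that by (auto simp: s_def)
    have s_inj: "s z \<noteq> s z'" if "z \<in> ?P" "z' \<in> ?P" "z \<noteq> z'" for z z'
      using that xy by (auto simp: s_def)
    have r_set: "set (r z) \<subseteq> set (p z) \<union> set (q (s z))" for z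
      unfolding r_def s_def by (cases "q z") auto
    have r_walk: "walk ?E A B (r z) \<and> distinct (r z)" if z: "z \<in> ?P" for z
    proof (cases "z = x")
      case True
      have "walk ?E A B (p x @ q y)"
        using pw(1)[of x] qw(1)[of y] p(2)[of x] q(2)[of y]
        by (intro walk_append[of _ A ?P _ ?Q]) (auto intro: walk_mono)
      moreover have "set (p x) \<inter> set (q y) = {}" using meet[of x y] xy by blast
      ultimately show ?thesis using True pw(2)[of x] qw(2)[of y] unfolding r_def by auto
    next
      case False
      then have zX: "z \<in> X" using z by blast
      have "walk ?E A B (p z @ tl (q z))"
        using pw(1)[of z] qw(1)[of z] p(2)[of z] q(2)[of z] zX
        by (intro walk_join[of _ A ?P _ ?Q]) (auto intro: walk_mono)
      moreover have "distinct (p z @ tl (q z))"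
      proof -
        have "q z = z # tl (q z)" using qw(1)[of z] q(2)[of z] zX unfolding walk_def
          by (metis insertI2 list.collapse)
        then have "distinct (z # tl (q z))" "set (tl (q z)) \<subseteq> set (q z)"
          using qw(2)[of z] zX by (metis insertI2, metis set_subset_Cons)
        then show ?thesis using pw(2)[of z] meet[of z z] zX by auto
      qed
      ultimately show ?thesis using False unfolding r_def by auto
    qed
    have r_disj: "set (r z) \<inter> set (r z') = {}" if z: "z \<in> ?P" "z' \<in> ?P" "z \<noteq> z'" for z z'
    proof -
      have False if "v \<in> set (r z)" "v \<in> set (r z')" for v
        using that r_set[of z] r_set[of z'] p(4)[OF z] q(4)[OF s[OF z(1)] s[OF z(2)] s_inj[OF z]]
          meet[OF z(1) s[OF z(2)], of v] meet[OF z(2) s[OF z(1)], of v] z xy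
        by (auto simp: s_def split: if_splits)
      then show ?thesis by blast
    qed
    have "inj_on r ?P"
      using r_disj r_walk unfolding inj_on_def walk_def by (metis Int_absorb set_empty)
    then have "card (r ` ?P) = k" using cardP card_image by metis
    moreover have "linkage ?E A B (r ` ?P)"
      unfolding linkage_def using r_walk r_disj X(1) by blast
    ultimately show ?thesis using e by blast
  qed
qed

section \<open>Connectivity in finite simple graphs\<close>

lemma arcs_ends_induce: "arcs_ends (G \<restriction> W) = arcs_ends G \<inter> W \<times> W"
  by (auto simp: arcs_ends_conv)

lemma (in graph) graph_induce:
  assumes "W \<subseteq> verts G" shows "graph (G \<restriction> W)"
proof -
  have ind: "induced_subgraph (G \<restriction> W) G" using assms by (rule induced_induce)
  interpret H: digraph "G \<restriction> W" using ind by (rule digraphI_induced)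
  show ?thesis using induced_graph_imp_symmetric[OF sym_arcs ind] by (rule H.graphI)
qed

lemma (in graph) deg_eq_card: "deg G v = card (arcs_ends G `` {v})"
proof -
  have "inj_on (head G) (out_arcs G v)"
    using no_multi_arcs by (auto simp: inj_on_def arc_to_ends_def)
  moreover have "head G ` out_arcs G v = arcs_ends G `` {v}"
    by (auto simp: arcs_ends_conv image_iff Bex_def)
  ultimately show ?thesis unfolding out_degree_def using card_image by metis
qed

lemma (in graph) deg_induce:
  assumes "W \<subseteq> verts G" "v \<in> W"
  shows "deg (G \<restriction> W) v = card (arcs_ends G `` {v} \<inter> W)"
proof -
  interpret H: graph "G \<restriction> W" using assms(1) by (rule graph_induce)
  have "arcs_ends (G \<restriction> W) `` {v} = arcs_ends G `` {v} \<inter> W"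
    using assms(2) by (auto simp: arcs_ends_induce)
  then show ?thesis using H.deg_eq_card by simp
qed

lemma (in graph) finite_nbrs: "finite (arcs_ends G `` {v})"
  by (rule finite_subset[OF _ finite_verts]) (auto dest: adj_in_verts)

section \<open>Connectedness, vertex cutsets and components\<close>

lemma (in wf_digraph) strongly_connected_imp_connected:
  "strongly_connected G \<Longrightarrow> Digraph_Component.connected G"
  by (rule connectedI) (auto simp: strongly_connected_def intro: reachable_mk_symmetricI)

lemma (in sym_digraph) connected_iff_strongly_connected:
  "Digraph_Component.connected G \<longleftrightarrow> strongly_connected G"
  using symmetric_connected_imp_strongly_connected[OF sym_arcs] strongly_connected_imp_connected
  by blast

text \<open>The set of vertices reachable from a given one has no outgoing arc. This form lets
  cutsets be produced and used without mentioning walks.\<close>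

lemma (in sym_digraph) connected_iff_no_closed_set:
  "Digraph_Component.connected G \<longleftrightarrow>
     verts G \<noteq> {} \<and> (\<forall>A. A \<noteq> {} \<longrightarrow> A \<subset> verts G \<longrightarrow> (\<exists>x\<in>A. \<exists>y\<in>verts G - A. x \<rightarrow> y))"
  unfolding connected_iff_strongly_connected
proof (intro iffI conjI allI impI)
  assume sc: "strongly_connected G"
  then show "verts G \<noteq> {}" by (simp add: strongly_connected_def)
  fix A assume A: "A \<noteq> {}" "A \<subset> verts G"
  then obtain u v where uv: "u \<in> A" "v \<in> verts G - A" by blast
  then have "u \<rightarrow>\<^sup>* v" using sc A by (auto simp: strongly_connected_def)
  then show "\<exists>x\<in>A. \<exists>y\<in>verts G - A. x \<rightarrow> y"
  proof (rule contrapos_pp)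
    assume n: "\<not> (\<exists>x\<in>A. \<exists>y\<in>verts G - A. x \<rightarrow> y)"
    have "w \<in> A" if "u \<rightarrow>\<^sup>* w" for w
      using that by (induction rule: reachable_induct) (use uv n adj_in_verts in blast)+
    then show "\<not> u \<rightarrow>\<^sup>* v" using uv by blast
  qed
next
  assume *: "verts G \<noteq> {} \<and> (\<forall>A. A \<noteq> {} \<longrightarrow> A \<subset> verts G \<longrightarrow> (\<exists>x\<in>A. \<exists>y\<in>verts G - A. x \<rightarrow> y))"
  show "strongly_connected G"
  proof (rule strongly_connectedI)
    fix u v assume uv: "u \<in> verts G" "v \<in> verts G"
    let ?A = "{w. u \<rightarrow>\<^sup>* w}"
    have "?A \<subseteq> verts G" by (auto dest: reachable_in_verts)
    moreover have "\<not> ?A \<subset> verts G"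
    proof
      assume "?A \<subset> verts G"
      then obtain x y where "u \<rightarrow>\<^sup>* x" "\<not> u \<rightarrow>\<^sup>* y" "x \<rightarrow> y"
        using * uv(1) reachable_refl by (metis (no_types, lifting) DiffE empty_iff mem_Collect_eq)
      then show False using reachable_adj_trans by blast
    qed
    ultimately show "u \<rightarrow>\<^sup>* v" using uv by blast
  qed (use * in blast)
qed

text \<open>\<open>A\<close> is one side of the separation. Requiring a nonempty proper subset
  already excludes the removal of all vertices.\<close>

lemma (in graph) vertex_cutset_iff:
  "vertex_cutset G X \<longleftrightarrow> X \<subseteq> verts G \<and>
     (\<exists>A. A \<noteq> {} \<and> A \<subset> verts G - X \<and> (\<forall>x\<in>A. \<forall>y\<in>verts G - X - A. \<not> x \<rightarrow> y))"
proof -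
  interpret H: graph "G \<restriction> (verts G - X)" by (rule graph_induce) blast
  have "Digraph_Component.connected (del_verts G X) \<longleftrightarrow> verts G - X \<noteq> {} \<and>
     (\<forall>A. A \<noteq> {} \<longrightarrow> A \<subset> verts G - X \<longrightarrow> (\<exists>x\<in>A. \<exists>y\<in>verts G - X - A. x \<rightarrow>\<^bsub>G \<restriction> (verts G - X)\<^esub> y))"
    unfolding del_verts_def by (subst H.connected_iff_no_closed_set) simp
  also have "\<dots> \<longleftrightarrow> verts G - X \<noteq> {} \<and>
     (\<forall>A. A \<noteq> {} \<longrightarrow> A \<subset> verts G - X \<longrightarrow> (\<exists>x\<in>A. \<exists>y\<in>verts G - X - A. x \<rightarrow> y))"
    unfolding arcs_ends_induce by blast
  finally have conn: "Digraph_Component.connected (del_verts G X) \<longleftrightarrow> verts G - X \<noteq> {} \<and>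
     (\<forall>A. A \<noteq> {} \<longrightarrow> A \<subset> verts G - X \<longrightarrow> (\<exists>x\<in>A. \<exists>y\<in>verts G - X - A. x \<rightarrow> y))" .
  show ?thesis
  proof (cases "X \<subset> verts G")
    case True
    then have "verts G - X \<noteq> {}" "X \<subseteq> verts G" by auto
    then show ?thesis using True conn by (simp add: vertex_cutset_def)
  qed (auto simp: vertex_cutset_def)
qed

lemma (in graph) complete_iff:
  "complete G \<longleftrightarrow> (\<forall>u\<in>verts G. \<forall>v\<in>verts G. u \<noteq> v \<longrightarrow> u \<rightarrow> v)"
proof -
  have "graph G" by unfold_locales
  moreover have "arcs_ends G \<subseteq> {(u, v). (u, v) \<in> verts G \<times> verts G \<and> u \<noteq> v}"
    using adj_in_verts adj_not_same by blast
  ultimately show ?thesis unfolding complete_def complete_digraph_def by blast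
qed

text \<open>Removing everything except two nonadjacent vertices disconnects the graph, so the
  minimum is taken over a nonempty finite set.\<close>

lemma (in graph) le_vertex_connectivity_iff:
  assumes "\<not> complete G"
  shows "k \<le> vertex_connectivity G \<longleftrightarrow> (\<forall>X. vertex_cutset G X \<longrightarrow> k \<le> card X)"
proof -
  obtain u v where uv: "u \<in> verts G" "v \<in> verts G" "u \<noteq> v" "\<not> u \<rightarrow> v"
    using assms complete_iff by blast
  have "vertex_cutset G (verts G - {u, v})"
    unfolding vertex_cutset_iff using uv by (intro conjI exI[of _ "{u}"]) auto
  moreover have "finite {X. vertex_cutset G X}"
    by (rule finite_subset[of _ "Pow (verts G)"]) (auto simp: vertex_cutset_def)
  then have "finite {card X | X. vertex_cutset G X}" by simp
  ultimately show ?thesis using assms unfolding vertex_connectivity_def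
    by (subst if_not_P, simp, subst Min_ge_iff) auto
qed

text \<open>Additional arcs on the same vertices preserve connectedness; this is why maximal
  connected subgraphs are induced.\<close>

lemma arc_mono_connected: "arc_mono Digraph_Component.connected"
  unfolding arc_mono_def
proof (intro allI impI)
  fix H1 H2 :: "('a, 'b) pre_digraph"
  assume *: "Digraph_Component.connected H1 \<and> subgraph H1 H2 \<and> verts H1 = verts H2"
  then interpret wf_digraph H2 by (simp add: subgraph_def)
  show "Digraph_Component.connected H2"
    using * connected_spanning_imp_connected unfolding spanning_def by blast
qed

text \<open>Components are maximal among all connected subgraphs, strongly connected components
  among the induced ones. A connected subgraph can be replaced by the subgraph induced on its
  vertices, and symmetry identifies the two notions of connectedness.\<close>

lemma (in sym_digraph) components_eq_sccs: "components G = sccs"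
proof (intro set_eqI iffI)
  fix C assume "C \<in> components G"
  then have C: "max_subgraph Digraph_Component.connected C" by (simp add: components_def)
  then have ind: "induced_subgraph C G" by (rule induced_subgraphI_arc_mono[OF _ arc_mono_connected])
  interpret C: sym_digraph C using ind by (rule induced_graph_imp_graph)
  have "strongly_connected C" using C C.connected_iff_strongly_connected max_subgraph_prop by blast
  moreover have False
    if H: "induced_subgraph H G" "strongly_connected H" "verts C \<subset> verts H" for H
  proof -
    interpret H: sym_digraph H using H(1) by (rule induced_graph_imp_graph)
    have "compatible G C" "compatible G H"
      using ind H(1) unfolding induced_subgraph_def subgraph_def by blast+
    then have "compatible H C" by (simp add: compatible_def)
    moreover have "arcs C \<subseteq> arcs H"
      using ind H(1,3) unfolding induced_subgraph_def by blast
    ultimately have "subgraph C H"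
      using H(3) H.wf_digraph C.wf_digraph by (intro subgraphI) auto
    moreover have "Digraph_Component.connected H" "subgraph H G" "H \<noteq> C"
      using H H.strongly_connected_imp_connected induced_imp_subgraph by auto
    ultimately show False using C unfolding max_subgraph_def by simp
  qed
  ultimately show "C \<in> sccs" using ind by blast
next
  fix C assume C: "C \<in> sccs"
  then have ind: "induced_subgraph C G" by (rule in_sccs_imp_induced)
  interpret C: sym_digraph C using ind by (rule induced_graph_imp_graph)
  have False if H: "C \<noteq> H" "subgraph C H" "subgraph H G" "Digraph_Component.connected H" for H
  proof -
    let ?K = "G \<restriction> verts H"
    have K: "induced_subgraph ?K G" using H(3) by (intro induced_induce) (auto simp: subgraph_def)
    interpret K: sym_digraph ?K using K by (rule induced_graph_imp_graph)
    have "subgraph H ?K" using H(3) by (rule subgraph_induce_subgraphI2)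
    then have "Digraph_Component.connected ?K"
      using H(4) arc_mono_connected unfolding arc_mono_def by (metis induce_subgraph_verts)
    then have "strongly_connected ?K" using K.connected_iff_strongly_connected by blast
    \<comment> \<open>On the same vertices \<open>H\<close> would contain all arcs of the induced
      subgraph \<open>C\<close> and thus be equal to it.\<close>
    moreover have "verts C \<noteq> verts H"
    proof
      assume "verts C = verts H"
      moreover have "induced_subgraph H G"
      proof (rule induced_subgraphI[OF H(3)])
        show "arcs H = {e \<in> arcs G. tail G e \<in> verts H \<and> head G e \<in> verts H}"
          using H(2) ind \<open>verts C = verts H\<close> \<open>subgraph H ?K\<close>
          unfolding induced_subgraph_def subgraph_def by auto
      qed
      ultimately have "C = H" using ind induced_eq_verts_imp_eq by blast
      then show False using H(1) by blast
    qed
    then have "verts C \<subset> verts ?K" using subgraph_imp_subverts[OF H(2)] by auto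
    ultimately show False using C K unfolding sccs_def by blast
  qed
  moreover have "Digraph_Component.connected C"
    using C C.strongly_connected_imp_connected unfolding sccs_def by blast
  ultimately show "C \<in> components G"
    unfolding components_def using ind by (auto intro: max_subgraphI)
qed

lemma (in sym_digraph) scc_closed:
  assumes "C \<in> sccs" "x \<in> verts C" "x \<rightarrow> y" shows "y \<in> verts C"
proof -
  have "x \<in> verts G" using adj_in_verts assms(3) by blast
  then have "G \<restriction> {v. x \<rightarrow>\<^sup>* v} \<in> sccs" "x \<in> verts (G \<restriction> {v. x \<rightarrow>\<^sup>* v})"
    using induce_reachable_is_in_sccs by auto
  then have "C = G \<restriction> {v. x \<rightarrow>\<^sup>* v}" using scc_disj assms by blast
  then show ?thesis using assms(3) by (metis induce_subgraph_verts mem_Collect_eq reachable_adjI)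
qed

section \<open>Internally disjoint paths and local connectivity\<close>

lemma finite_pairwise_subsets: "finite A \<Longrightarrow> finite {card P | P. P \<subseteq> A \<and> Q P}"
  by (rule finite_subset[of _ "card ` Pow A"]) auto

context graph begin

lemma finite_paths_between: "finite (paths_between G u v)"
  using vpaths_finite by (rule rev_finite_subset) (auto simp: paths_between_def)

lemma local_connectivity_ge:
  assumes "P \<subseteq> paths_between G u v" "pairwise internally_disjoint P"
  shows "card P \<le> local_connectivity G u v"
  unfolding local_connectivity_def
  by (rule Max_ge) (use assms finite_pairwise_subsets[OF finite_paths_between] in auto)

text \<open>The empty family makes the set under \<open>Max\<close> nonempty, so the maximum is
  attained.\<close>

lemma local_connectivity_obtain:
  obtains P where "P \<subseteq> paths_between G u v" "pairwise internally_disjoint P"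
    "card P = local_connectivity G u v"
proof -
  have "local_connectivity G u v \<in> {card P | P. P \<subseteq> paths_between G u v \<and> pairwise internally_disjoint P}"
    unfolding local_connectivity_def
    by (rule Max_in) (use finite_pairwise_subsets[OF finite_paths_between] pairwise_empty in auto)
  then show thesis using that by auto
qed

lemma path_decomp:
  assumes "p \<in> paths_between G u v" "u \<noteq> v"
  obtains m where "p = u # m @ [v]" "distinct (u # m @ [v])" "internal_verts p = set m"
    "set (vwalk_arcs p) \<subseteq> arcs_ends G" "set p \<subseteq> verts G"
proof -
  obtain q where q: "p = u # q" "last p = v" using assms by (cases p) (auto simp: paths_between_def vpath_def)
  obtain m where "p = u # m @ [v]" using assms q by (cases q rule: rev_cases) auto
  then show thesis using that assms
    by (auto simp: paths_between_def vpath_def vwalk_def internal_verts_def)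
qed

lemma internal_verts_path:
  assumes "p \<in> paths_between G u v" "u \<noteq> v"
  shows "internal_verts p = set p - {u, v}"
  using assms by (rule path_decomp) auto

lemma second_vertex_path:
  assumes "p \<in> paths_between G u v" "u \<noteq> v"
  shows "u \<rightarrow> hd (tl p)" "hd (tl p) \<in> set p" "hd (tl p) = v \<longleftrightarrow> p = [u, v]"
    "hd (tl p) \<noteq> v \<Longrightarrow> hd (tl p) \<in> internal_verts p"
  using assms by (rule path_decomp, case_tac m; auto)+

text \<open>A second vertex other than \<open>v\<close> is internal and so lies on one path only;
  second vertex \<open>v\<close> means that the path is the edge \<open>[u, v]\<close>.\<close>

lemma inj_on_second_vertex:
  assumes "P \<subseteq> paths_between G u v" "u \<noteq> v" "pairwise internally_disjoint P"
  shows "inj_on (\<lambda>p. hd (tl p)) P"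
proof (rule inj_onI, rule ccontr)
  fix p q assume pq: "p \<in> P" "q \<in> P" "hd (tl p) = hd (tl q)" "p \<noteq> q"
  then have "internal_verts p \<inter> internal_verts q = {}"
    using assms(3) unfolding pairwise_def internally_disjoint_def by blast
  moreover have "p \<in> paths_between G u v" "q \<in> paths_between G u v" using pq assms(1) by auto
  ultimately show False using second_vertex_path assms(2) pq(3,4)
    by (metis disjoint_iff)
qed

text \<open>Equality of the two finite cardinalities turns the injection into a bijection: every
  edge at \<open>u\<close> starts one of the paths.\<close>

lemma saturated_second_vertices:
  assumes "P \<subseteq> paths_between G u v" "pairwise internally_disjoint P" "u \<noteq> v" "card P = deg G u"
  shows "(\<lambda>p. hd (tl p)) ` P = arcs_ends G `` {u}"
proof (rule card_subset_eq[OF finite_nbrs])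
  show "(\<lambda>p. hd (tl p)) ` P \<subseteq> arcs_ends G `` {u}"
    using assms second_vertex_path(1) by blast
  show "card ((\<lambda>p. hd (tl p)) ` P) = card (arcs_ends G `` {u})"
    using assms deg_eq_card inj_on_second_vertex by (simp add: card_image)
qed

lemma paths_between_rev: "p \<in> paths_between G u v \<Longrightarrow> rev p \<in> paths_between G v u"
  using vwalk_rev_ex[OF sym_arcs] unfolding paths_between_def vpath_def
  by (auto simp: hd_rev last_rev)

lemma internal_verts_rev: "internal_verts (rev p) = internal_verts p"
  unfolding internal_verts_def by (metis butlast_rev butlast_tl rev_swap set_rev)

lemma local_connectivity_le_swap: "local_connectivity G u v \<le> local_connectivity G v u"
proof -
  obtain P where P: "P \<subseteq> paths_between G u v" "pairwise internally_disjoint P"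
    "card P = local_connectivity G u v" by (rule local_connectivity_obtain)
  have "card (rev ` P) \<le> local_connectivity G v u"
    using P paths_between_rev
    by (intro local_connectivity_ge)
      (auto simp: pairwise_def internally_disjoint_def internal_verts_rev)
  then show ?thesis using P(3) by (simp add: card_image)
qed

lemma local_connectivity_commute: "local_connectivity G u v = local_connectivity G v u"
  using local_connectivity_le_swap by (simp add: antisym)

text \<open>The paths leave \<open>u\<close> through different neighbours; reversing them gives the
  bound at \<open>v\<close>.\<close>

lemma local_connectivity_le_deg:
  assumes "u \<noteq> v" shows "local_connectivity G u v \<le> min (deg G u) (deg G v)"
proof -
  have *: "local_connectivity G u v \<le> deg G u" if "u \<noteq> v" for u v
  proof -
    obtain P where P: "P \<subseteq> paths_between G u v" "pairwise internally_disjoint P"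
      "card P = local_connectivity G u v" by (rule local_connectivity_obtain)
    have "card P \<le> card (arcs_ends G `` {u})"
      using inj_on_second_vertex[OF P(1) that P(2)] _ finite_nbrs
      by (rule card_inj_on_le) (use P(1) that second_vertex_path(1) in blast)
    then show ?thesis using P(3) deg_eq_card by simp
  qed
  show ?thesis using *[of u v] *[of v u] local_connectivity_commute[of u v] assms by simp
qed

lemma ideally_connected_iff:
  "ideally_connected G \<longleftrightarrow>
    (\<forall>u\<in>verts G. \<forall>v\<in>verts G. u \<noteq> v \<longrightarrow> min (deg G u) (deg G v) \<le> local_connectivity G u v)"
  unfolding ideally_connected_def using local_connectivity_le_deg by (simp add: eq_iff)

text \<open>Menger's theorem is applied between the neighbourhoods of \<open>u\<close> and
  \<open>v\<close> in \<open>G - {u, v}\<close>. Attaching \<open>u\<close> and \<open>v\<close> to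
  the disjoint paths of a linkage yields internally disjoint paths.\<close>

lemma le_local_connectivity_nonadjacent:
  assumes uv: "u \<in> verts G" "v \<in> verts G" "u \<noteq> v" "\<not> u \<rightarrow> v"
    and cut: "\<And>X. vertex_cutset G X \<Longrightarrow> k \<le> card X"
  shows "k \<le> local_connectivity G u v"
proof -
  let ?V = "verts G - {u, v}"
  let ?A = "arcs_ends G `` {u}" and ?B = "arcs_ends G `` {v}" and ?F = "arcs_ends G \<inter> ?V \<times> ?V"
  have AB: "?A \<subseteq> ?V" "?B \<subseteq> ?V"
    using uv(4) adj_in_verts adj_not_same graph_symmetric by blast+
  \<comment> \<open>A one-vertex walk has no arc to confine it to \<open>?V\<close>, so the start is
    placed there by \<open>AB\<close>; the arcs of \<open>?F\<close> keep the rest inside.\<close>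
  have V: "set p \<subseteq> ?V" if p: "walk ?F ?A ?B p" for p
  proof -
    obtain a q where "p = a # q" using p unfolding walk_def by (cases p) auto
    moreover then have "a \<in> ?V" using p AB unfolding walk_def by auto
    moreover have "set (vwalk_arcs (a # q)) \<subseteq> ?F \<Longrightarrow> a \<in> ?V \<Longrightarrow> set (a # q) \<subseteq> ?V" for a q
      by (induction q arbitrary: a) auto
    ultimately show ?thesis using p unfolding walk_def by blast
  qed
  have "\<exists>P. linkage ?F ?A ?B P \<and> card P = k"
  proof (rule menger)
    fix X assume X: "finite X" "separates ?F ?A ?B X"
    \<comment> \<open>A separator in \<open>menger\<close> may contain \<open>u\<close> or
      \<open>v\<close>; trimming it leaves both in the remaining graph.\<close>
    let ?X = "X \<inter> ?V"
    have "vertex_cutset G ?X"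
    proof (rule ccontr)
      interpret K: graph "G \<restriction> (verts G - ?X)" by (rule graph_induce) blast
      assume "\<not> vertex_cutset G ?X"
      then have "Digraph_Component.connected (G \<restriction> (verts G - ?X))"
        using uv unfolding vertex_cutset_def del_verts_def by blast
      then have "u \<rightarrow>\<^sup>*\<^bsub>G \<restriction> (verts G - ?X)\<^esub> v"
        using uv unfolding K.connected_iff_strongly_connected strongly_connected_def by simp
      then obtain p where p: "p \<in> paths_between (G \<restriction> (verts G - ?X)) u v"
        using K.reachable_vpath_conv unfolding paths_between_def by auto
      then obtain m where m: "p = u # m @ [v]" "distinct (u # m @ [v])"
        "set (vwalk_arcs p) \<subseteq> arcs_ends (G \<restriction> (verts G - ?X))" "set p \<subseteq> verts G - ?X"
        using uv(3) by (metis K.path_decomp induce_subgraph_verts)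
      \<comment> \<open>As \<open>u\<close> and \<open>v\<close> are not adjacent, the path has an
        interior, and this is a walk between the neighbourhoods that avoids
        \<open>X\<close>.\<close>
      have "m \<noteq> []" using m uv(4) by (auto simp: arcs_ends_induce)
      then have arcs: "vwalk_arcs p = (u, hd m) # vwalk_arcs m @ [(last m, v)]"
        using m by (simp add: vwalk_arcs_append)
      have "set (vwalk_arcs m) \<subseteq> ?F"
        using m arcs arcs_in_vwalk_arcs[of _ m] by (auto simp: arcs_ends_induce)
      then have "walk ?F ?A ?B m"
        using m(3) \<open>m \<noteq> []\<close> graph_symmetric unfolding walk_def arcs by (auto simp: arcs_ends_induce)
      then have "set m \<inter> X \<noteq> {}" "set m \<subseteq> ?V" using X V unfolding separates_def by auto
      then show False using m by auto
    qed
    then have "k \<le> card ?X" by (rule cut)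
    also have "\<dots> \<le> card X" using X(1) by (intro card_mono) auto
    finally show "k \<le> card X" .
  qed (auto intro: finite_nbrs finite_subset[of _ "verts G \<times> verts G"])
  then obtain P where P: "linkage ?F ?A ?B P" "card P = k" by blast
  define f where "f m = u # m @ [v]" for m
  have "f m \<in> paths_between G u v" if "m \<in> P" for m
  proof -
    have m: "walk ?F ?A ?B m" "distinct m" using P(1) that unfolding linkage_def by auto
    then have "set m \<subseteq> ?V" "m \<noteq> []" using V unfolding walk_def by auto
    then show ?thesis using m uv graph_symmetric
      by (auto simp: f_def paths_between_def vpath_def vwalk_def walk_def vwalk_arcs_append)
  qed
  moreover have "pairwise internally_disjoint (f ` P)"
    using P(1) unfolding linkage_def
    by (auto simp: pairwise_def internally_disjoint_def internal_verts_def f_def)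
  ultimately have "card (f ` P) \<le> local_connectivity G u v"
    by (intro local_connectivity_ge) auto
  moreover have "card (f ` P) = k" using P(2) by (simp add: card_image inj_on_def f_def)
  ultimately show ?thesis by simp
qed

end

section \<open>One part of a graph separated by a clique\<close>

lemma last_filter: "xs \<noteq> [] \<Longrightarrow> P (last xs) \<Longrightarrow> last (filter P xs) = last xs"
  by (cases xs rule: rev_cases) auto

text \<open>\<open>D\<close> is any nonempty union of components of \<open>G - S\<close>, described
  by closedness under adjacency up to \<open>S\<close>.\<close>

locale clique_separation = graph G for G :: "('a, 'b) pre_digraph" (structure) +
  fixes S D :: "'a set"
  assumes S_verts: "S \<subseteq> verts G"
    and clique: "\<And>s s'. s \<in> S \<Longrightarrow> s' \<in> S \<Longrightarrow> s \<noteq> s' \<Longrightarrow> s \<rightarrow> s'"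
    and D_verts: "D \<subseteq> verts G - S"
    and D_nonempty: "D \<noteq> {}"
    and D_closed: "\<And>x y. x \<in> D \<Longrightarrow> x \<rightarrow> y \<Longrightarrow> y \<in> D \<union> S"
begin

abbreviation W :: "'a set" where "W \<equiv> D \<union> S"

abbreviation H :: "('a, 'b) pre_digraph" where "H \<equiv> G \<restriction> W"

lemma W_verts: "W \<subseteq> verts G" using S_verts D_verts by auto

sublocale H: graph H using W_verts by (rule graph_induce)

lemma finite_S: "finite S" using S_verts finite_verts finite_subset by blast

text \<open>Induction from the front. The last clause is the invariant: a walk starting outside
  \<open>W\<close> enters it through \<open>S\<close>. A walk leaving \<open>W\<close> does so from
  \<open>S\<close>, so the clique supplies the edge that replaces the excursion; distinctness makes
  its two ends different.\<close>

lemma filter_walk: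
  assumes "vwalk p G" "distinct p" "last p \<in> W"
  shows "vwalk (filter (\<lambda>x. x \<in> W) p) H" "hd p \<in> W \<Longrightarrow> hd (filter (\<lambda>x. x \<in> W) p) = hd p"
    "hd p \<notin> W \<Longrightarrow> hd (filter (\<lambda>x. x \<in> W) p) \<in> S"
proof -
  let ?f = "filter (\<lambda>x. x \<in> W)"
  have "vwalk (?f p) H \<and> (hd p \<in> W \<longrightarrow> hd (?f p) = hd p) \<and> (hd p \<notin> W \<longrightarrow> hd (?f p) \<in> S)"
    using assms
  proof (induction rule: vwalk_induct)
    case (Base u)
    then show ?case by auto
  next
    case (Cons u v es)
    let ?q = "?f (v # es)"
    have IH: "vwalk ?q H" "v \<in> W \<Longrightarrow> hd ?q = v" "v \<notin> W \<Longrightarrow> hd ?q \<in> S" using Cons by auto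
    show ?case
    proof (cases "u \<in> W")
      case True
      have hd: "hd ?q \<in> set ?q" using IH(1) hd_in_set unfolding vwalk_def by blast
      then have "hd ?q \<in> set (v # es)" "hd ?q \<in> W" unfolding set_filter by blast+
      then have "u \<noteq> hd ?q" using Cons.prems by auto
      then have "u \<rightarrow> hd ?q" using IH(2,3) True Cons.hyps D_closed clique by (cases "v \<in> W") auto
      then have "vwalk (u # ?q) H" using IH(1) True \<open>hd ?q \<in> W\<close>
        by (intro vwalk_consI) (auto simp: arcs_ends_induce)
      then show ?thesis using True by simp
    next
      case False
      then have "v \<in> W \<Longrightarrow> v \<in> S" using Cons.hyps D_closed graph_symmetric by blast
      then show ?thesis using IH False by auto
    qed
  qed
  then show "vwalk (?f p) H" "hd p \<in> W \<Longrightarrow> hd (?f p) = hd p" "hd p \<notin> W \<Longrightarrow> hd (?f p) \<in> S"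
    by auto
qed

lemma filter_path:
  assumes "p \<in> paths_between G u v" "u \<in> W" "v \<in> W"
  shows "filter (\<lambda>x. x \<in> W) p \<in> paths_between H u v"
  using assms filter_walk[of p] last_filter[of p "\<lambda>x. x \<in> W"]
  unfolding paths_between_def vpath_def by (auto simp: vwalk_def)

text \<open>Discarding the vertices outside \<open>W\<close> keeps a family of internally disjoint paths internally
  disjoint, but paths may collapse to the edge \<open>uv\<close>; the paths entering \<open>W\<close> at once do not.\<close>

lemma card_paths_into_H:
  assumes P: "P \<subseteq> paths_between G u v" "pairwise internally_disjoint P"
    and uv: "u \<noteq> v" "u \<in> W" "v \<in> W"
  shows "card {p \<in> P. hd (tl p) \<in> W} \<le> local_connectivity H u v"
proof -
  let ?f = "filter (\<lambda>x. x \<in> W)" and ?Q = "{p \<in> P. hd (tl p) \<in> W}"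
  \<comment> \<open>The second vertex survives filtering and determines the path, so different paths
    stay different.\<close>
  have second: "hd (tl (?f p)) = hd (tl p)" if "p \<in> ?Q" for p
  proof -
    have "p \<in> paths_between G u v" using that P(1) by auto
    then obtain m where "p = u # m @ [v]" using uv(1) by (rule path_decomp)
    then show ?thesis using that uv by (cases m) auto
  qed
  have "inj_on ?f ?Q"
  proof (rule inj_onI)
    fix p q assume pq: "p \<in> ?Q" "q \<in> ?Q" "?f p = ?f q"
    then have "hd (tl p) = hd (tl q)" using second by metis
    then show "p = q" using inj_on_second_vertex[OF P(1) uv(1) P(2)] pq unfolding inj_on_def by auto
  qed
  then have "card ?Q = card (?f ` ?Q)" by (simp add: card_image)
  also have "\<dots> \<le> local_connectivity H u v"
  proof (rule H.local_connectivity_ge)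
    show f: "?f ` ?Q \<subseteq> paths_between H u v" using filter_path P(1) uv by blast
    have int: "internal_verts (?f p) \<subseteq> internal_verts p" if "p \<in> ?Q" for p
      using H.internal_verts_path[of "?f p" u v] internal_verts_path[of p u v] f P(1) that uv(1) by auto
    show "pairwise internally_disjoint (?f ` ?Q)"
    proof (rule pairwise_imageI)
      fix p q assume "p \<in> ?Q" "q \<in> ?Q" "p \<noteq> q"
      moreover then have "internal_verts p \<inter> internal_verts q = {}"
        using P(2) unfolding pairwise_def internally_disjoint_def by blast
      ultimately show "internally_disjoint (?f p) (?f q)"
        using int[of p] int[of q] unfolding internally_disjoint_def by blast
    qed
  qed
  finally show ?thesis .
qed

text \<open>All neighbours of \<open>u\<close> lie in \<open>W\<close>, so no path collapses under
  filtering.\<close>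

lemma local_connectivity_le_H:
  assumes "u \<in> D" "v \<in> W" "u \<noteq> v"
  shows "local_connectivity G u v \<le> local_connectivity H u v"
proof -
  obtain P where P: "P \<subseteq> paths_between G u v" "pairwise internally_disjoint P"
    "card P = local_connectivity G u v" by (rule local_connectivity_obtain)
  have "hd (tl p) \<in> W" if "p \<in> P" for p
    using that P(1) second_vertex_path(1)[of p u v] D_closed assms by blast
  then have "{p \<in> P. hd (tl p) \<in> W} = P" by blast
  then show ?thesis using card_paths_into_H[OF P(1,2)] P(3) assms by simp
qed

text \<open>Paths that use every edge at \<open>u\<close> use in particular the edges inside
  \<open>W\<close>, and the paths starting with those survive in \<open>H\<close>.\<close>

lemma deg_H_le_local_connectivity:
  assumes "u \<in> W" "v \<in> W" "u \<noteq> v" "local_connectivity G u v = deg G u"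
  shows "deg H u \<le> local_connectivity H u v"
proof -
  obtain P where P: "P \<subseteq> paths_between G u v" "pairwise internally_disjoint P"
    "card P = local_connectivity G u v" by (rule local_connectivity_obtain)
  have im: "(\<lambda>p. hd (tl p)) ` P = arcs_ends G `` {u}"
    using saturated_second_vertices P assms by simp
  have fin: "finite P" using P(1) finite_paths_between finite_subset by blast
  have "deg H u = card (arcs_ends G `` {u} \<inter> W)" using deg_induce W_verts assms(1) by blast
  also have "\<dots> = card ((\<lambda>p. hd (tl p)) ` {p \<in> P. hd (tl p) \<in> W})"
    unfolding im[symmetric] by (rule arg_cong[of _ _ card]) blast
  also have "\<dots> \<le> card {p \<in> P. hd (tl p) \<in> W}" using fin by (intro card_image_le) simp
  also have "\<dots> \<le> local_connectivity H u v" using card_paths_into_H P assms by blast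
  finally show ?thesis .
qed

lemma paths_between_H: "paths_between H u v \<subseteq> paths_between G u v"
  using vpathI_subgraph subgraph_induce_subgraphI[OF W_verts] unfolding paths_between_def by blast

lemma local_connectivity_H_le: "local_connectivity H u v \<le> local_connectivity G u v"
proof -
  obtain P where P: "P \<subseteq> paths_between H u v" "pairwise internally_disjoint P"
    "card P = local_connectivity H u v" by (rule H.local_connectivity_obtain)
  then show ?thesis using local_connectivity_ge[of P u v] paths_between_H by auto
qed

section \<open>Degrees and connectivity of one part\<close>

lemma deg_H_D: "u \<in> D \<Longrightarrow> deg H u = deg G u"
  using deg_induce[OF W_verts, of u] deg_eq_card D_closed
  by (metis Image_singleton_iff Int_absorb2 UnI1 subsetI)

lemma deg_H_S: "s \<in> S \<Longrightarrow> deg H s = card S - 1 + card (arcs_ends G `` {s} \<inter> D)"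
proof -
  assume s: "s \<in> S"
  have "arcs_ends G `` {s} \<inter> W = (S - {s}) \<union> arcs_ends G `` {s} \<inter> D"
    using s clique adj_not_same by blast
  moreover have "card ((S - {s}) \<union> arcs_ends G `` {s} \<inter> D) = card (S - {s}) + card (arcs_ends G `` {s} \<inter> D)"
    using finite_S finite_nbrs D_verts by (intro card_Un_disjoint) auto
  ultimately show ?thesis using deg_induce[OF W_verts, of s] s finite_S by simp
qed

text \<open>Otherwise \<open>S - {s}\<close> would still separate \<open>D\<close> from
  \<open>s\<close>, although it is smaller than every cutset may be.\<close>

lemma ex_nbr_in_D:
  assumes cut: "\<And>X. vertex_cutset G X \<Longrightarrow> card S \<le> card X" and s: "s \<in> S"
  shows "arcs_ends G `` {s} \<inter> D \<noteq> {}"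
proof
  assume n: "arcs_ends G `` {s} \<inter> D = {}"
  have "\<not> x \<rightarrow> y" if "x \<in> D" "y \<in> verts G - (S - {s}) - D" for x y
    using that n D_closed graph_symmetric by blast
  moreover have "D \<subset> verts G - (S - {s})" using D_verts S_verts s by blast
  ultimately have "vertex_cutset G (S - {s})"
    unfolding vertex_cutset_iff using D_nonempty S_verts by blast
  then have "card S \<le> card (S - {s})" by (rule cut)
  then show False using s finite_S by (metis card_Diff1_less not_le)
qed

text \<open>There are \<open>card S - 1\<close> neighbours in the clique and at least one in
  \<open>D\<close>.\<close>

lemma card_S_le_deg_H:
  assumes "\<And>X. vertex_cutset G X \<Longrightarrow> card S \<le> card X" "s \<in> S"
  shows "card S \<le> deg H s"
proof -
  have "card (arcs_ends G `` {s} \<inter> D) > 0"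
    using ex_nbr_in_D[OF assms] finite_nbrs by (simp add: card_gt_0_iff)
  then show ?thesis using deg_H_S[OF assms(2)] by simp
qed

text \<open>The clique \<open>S\<close> cannot meet both sides of a separation of \<open>H\<close>.
  The side missing \<open>S\<close> has the same neighbours in \<open>G\<close>, so the cutset of
  \<open>H\<close> is one of \<open>G\<close>.\<close>

lemma t_connected_H:
  assumes cut: "\<And>X. vertex_cutset G X \<Longrightarrow> card S \<le> card X"
  shows "t_connected (card S) H"
proof (cases "complete H")
  case True
  \<comment> \<open>For complete \<open>H\<close> the connectivity is \<open>card W - 1\<close>,
    which is at least \<open>card S\<close> because \<open>D\<close> is nonempty.\<close>
  have "card W = card D + card S"
    using D_verts finite_S finite_subset[OF D_verts] by (intro card_Un_disjoint) auto
  moreover have "card D > 0" using D_nonempty finite_subset[OF D_verts] by (simp add: card_gt_0_iff)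
  ultimately show ?thesis using True by (simp add: t_connected_def vertex_connectivity_def)
next
  case False
  have "card S \<le> card X" if X: "vertex_cutset H X" for X
  proof (rule ccontr)
    assume less: "\<not> card S \<le> card X"
    obtain A where A: "A \<noteq> {}" "A \<subset> W - X" "\<And>x y. x \<in> A \<Longrightarrow> y \<in> W - X - A \<Longrightarrow> \<not> x \<rightarrow>\<^bsub>H\<^esub> y"
      using X unfolding H.vertex_cutset_iff by auto
    have "X \<subseteq> W" using X unfolding vertex_cutset_def by auto
    have *: False if B: "B \<noteq> {}" "B \<subseteq> W - X" "B \<inter> S = {}" "\<And>x y. x \<in> B \<Longrightarrow> y \<in> W - X - B \<Longrightarrow> \<not> x \<rightarrow> y" for B
    proof -
      \<comment> \<open>By size some vertex of \<open>S\<close> survives outside \<open>X\<close>;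
        it is not in \<open>B\<close>, so \<open>B\<close> is a proper part of
        \<open>G - X\<close>.\<close>
      have "\<not> S \<subseteq> X" using less \<open>X \<subseteq> W\<close> W_verts finite_verts card_mono finite_subset by metis
      then have "B \<subset> verts G - X" using B(2,3) W_verts S_verts by blast
      moreover have "\<not> x \<rightarrow> y" if "x \<in> B" "y \<in> verts G - X - B" for x y
        using that B D_closed[of x y] by blast
      ultimately have "vertex_cutset G X"
        unfolding vertex_cutset_iff using B(1) \<open>X \<subseteq> W\<close> W_verts by blast
      then show False using cut less by blast
    qed
    have nA: "\<not> x \<rightarrow> y" "\<not> y \<rightarrow> x" if "x \<in> A" "y \<in> W - X - A" for x y
      using A(2,3) that graph_symmetric unfolding arcs_ends_induce by blast+
    have "A \<inter> S = {} \<or> (W - X - A) \<inter> S = {}" using nA(1) clique A(2) by blast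
    then show False
    proof
      assume "A \<inter> S = {}" then show False using *[of A] A(1,2) nA by blast
    next
      assume "(W - X - A) \<inter> S = {}" then show False using *[of "W - X - A"] A(1,2) nA by blast
    qed
  qed
  then show ?thesis unfolding t_connected_def using H.le_vertex_connectivity_iff[OF False] by blast
qed

text \<open>Each path crosses \<open>S\<close> in an internal vertex, and internally disjoint paths
  cross it in different ones.\<close>

lemma local_connectivity_across_le:
  assumes "u \<in> D" "v \<in> verts G - W"
  shows "local_connectivity G u v \<le> card S"
proof -
  have uv: "u \<noteq> v" using assms by auto
  obtain P where P: "P \<subseteq> paths_between G u v" "pairwise internally_disjoint P"
    "card P = local_connectivity G u v" by (rule local_connectivity_obtain)
  have "internal_verts p \<inter> S \<noteq> {}" if "p \<in> P" for p
  proof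
    assume n: "internal_verts p \<inter> S = {}"
    have p: "p \<in> paths_between G u v" using that P(1) by auto
    have "set p \<inter> S = {}" using n assms D_verts internal_verts_path[OF p uv] by auto
    moreover have "vwalk p G" "hd p \<in> D" "last p = v" using p assms
      unfolding paths_between_def vpath_def by auto
    moreover have "vwalk q G \<Longrightarrow> hd q \<in> D \<Longrightarrow> set q \<inter> S = {} \<Longrightarrow> last q \<in> D" for q
      by (induction rule: vwalk_induct) (auto dest: D_closed)
    ultimately show False using assms by blast
  qed
  then have "\<forall>p\<in>P. \<exists>x. x \<in> internal_verts p \<inter> S" by blast
  then obtain f where f: "\<And>p. p \<in> P \<Longrightarrow> f p \<in> internal_verts p \<inter> S" by metis
  have "inj_on f P"
  proof (rule inj_onI, rule ccontr)
    fix p q assume "p \<in> P" "q \<in> P" "f p = f q" "p \<noteq> q"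
    then show False using f[of p] f[of q] P(2) unfolding pairwise_def internally_disjoint_def by auto
  qed
  then have "card P \<le> card S" using f finite_S by (intro card_inj_on_le[of f]) auto
  then show ?thesis using P(3) by simp
qed

text \<open>When all neighbours of \<open>s\<close> in \<open>H\<close> are used, each vertex of \<open>S\<close> lies on a path leaving \<open>s\<close>
  through it, so the paths leaving \<open>s\<close> into \<open>D\<close> avoid \<open>S\<close>.\<close>

lemma paths_through_D:
  assumes s: "s \<in> S" "s' \<in> S" "s \<noteq> s'" and sat: "deg H s \<le> local_connectivity H s s'"
  obtains P where "P \<subseteq> paths_between G s s'" "pairwise internally_disjoint P"
    "\<And>p. p \<in> P \<Longrightarrow> internal_verts p \<subseteq> D"
    "arcs_ends G `` {s} \<inter> D \<subseteq> (\<lambda>p. hd (tl p)) ` P"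
proof -
  obtain Q where Q: "Q \<subseteq> paths_between H s s'" "pairwise internally_disjoint Q"
    "card Q = local_connectivity H s s'" by (rule H.local_connectivity_obtain)
  have "local_connectivity H s s' = deg H s"
    using sat H.local_connectivity_le_deg[of s s'] s by simp
  then have "card Q = deg H s" using Q(3) by simp
  then have im: "(\<lambda>p. hd (tl p)) ` Q = arcs_ends H `` {s}"
    using H.saturated_second_vertices Q s(3) by blast
  \<comment> \<open>Only the paths entering \<open>D\<close> at once are kept; the edges from
    \<open>s\<close> within \<open>S\<close> are common to all parts and are treated separately when
    parts are combined.\<close>
  define P where "P = {p \<in> Q. hd (tl p) \<in> D}"
  have "internal_verts p \<subseteq> D" if p: "p \<in> P" for p
  proof
    fix x assume x: "x \<in> internal_verts p"
    have pH: "p \<in> paths_between H s s'" using p Q(1) unfolding P_def by auto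
    then have "x \<in> W - {s, s'}"
      using x H.internal_verts_path[OF pH s(3)] unfolding paths_between_def vpath_def vwalk_def by auto
    moreover have False if xS: "x \<in> S"
    proof -
      have "x \<in> arcs_ends H `` {s}" using xS calculation s clique by (auto simp: arcs_ends_induce)
      then have "x \<in> (\<lambda>p. hd (tl p)) ` Q" unfolding im .
      then obtain q where q: "q \<in> Q" "hd (tl q) = x" by blast
      then have "x \<in> internal_verts q"
        using Q(1) calculation s(3) H.second_vertex_path(4)[of q s s'] by auto
      moreover have "q \<noteq> p" using q p xS D_verts unfolding P_def by auto
      ultimately show False
        using Q(2) q(1) p x unfolding P_def pairwise_def internally_disjoint_def by blast
    qed
    ultimately show "x \<in> D" by blast
  qed
  moreover have "P \<subseteq> paths_between G s s'" using Q(1) paths_between_H unfolding P_def by blast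
  moreover have "pairwise internally_disjoint P"
    using Q(2) unfolding P_def by (rule pairwise_subset) blast
  moreover have "arcs_ends G `` {s} \<inter> D \<subseteq> (\<lambda>p. hd (tl p)) ` P"
  proof
    fix w assume w: "w \<in> arcs_ends G `` {s} \<inter> D"
    then have "w \<in> (\<lambda>p. hd (tl p)) ` Q" unfolding im using s by (auto simp: arcs_ends_induce)
    then show "w \<in> (\<lambda>p. hd (tl p)) ` P" using w unfolding P_def by auto
  qed
  ultimately show thesis using that by blast
qed

end

section \<open>All parts of a graph separated by a clique\<close>

text \<open>\<open>other_part\<close> says that no part is alone, and \<open>card_S_le\<close> that
  no cutset is smaller than \<open>S\<close>. The index set is arbitrary, so the given enumeration
  can be used as it is.\<close>

locale clique_decomposition = graph G for G :: "('a, 'b) pre_digraph" (structure) +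
  fixes S :: "'a set" and I :: "'i set" and D :: "'i \<Rightarrow> 'a set"
  assumes S_verts: "S \<subseteq> verts G"
    and clique: "\<And>s s'. s \<in> S \<Longrightarrow> s' \<in> S \<Longrightarrow> s \<noteq> s' \<Longrightarrow> s \<rightarrow> s'"
    and parts: "(\<Union>i\<in>I. D i) = verts G - S"
    and parts_nonempty: "\<And>i. i \<in> I \<Longrightarrow> D i \<noteq> {}"
    and parts_disjoint: "\<And>i j. i \<in> I \<Longrightarrow> j \<in> I \<Longrightarrow> i \<noteq> j \<Longrightarrow> D i \<inter> D j = {}"
    and parts_closed: "\<And>i x y. i \<in> I \<Longrightarrow> x \<in> D i \<Longrightarrow> x \<rightarrow> y \<Longrightarrow> y \<in> D i \<union> S"
    and other_part: "\<And>i. i \<in> I \<Longrightarrow> \<exists>j\<in>I. j \<noteq> i"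
    and card_S_le: "\<And>X. vertex_cutset G X \<Longrightarrow> card S \<le> card X"
begin

abbreviation H :: "'i \<Rightarrow> ('a, 'b) pre_digraph" where "H i \<equiv> G \<restriction> (D i \<union> S)"

lemma clique_separation: "i \<in> I \<Longrightarrow> clique_separation G S (D i)"
  using S_verts clique parts parts_nonempty parts_closed by unfold_locales blast+

section \<open>Necessity of the conditions\<close>

lemma deg_H_le_deg:
  assumes "i \<in> I" "v \<in> D i \<union> S" shows "deg (H i) v \<le> deg G v"
proof -
  interpret P: clique_separation G S "D i" using assms(1) by (rule clique_separation)
  show ?thesis using deg_induce[OF P.W_verts assms(2)] deg_eq_card finite_nbrs
    by (simp add: card_mono)
qed

text \<open>\<open>s\<close> has a neighbour in another part, which \<open>H i\<close>
  omits.\<close>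

lemma deg_H_less_deg:
  assumes "i \<in> I" "s \<in> S" shows "deg (H i) s < deg G s"
proof -
  obtain j where j: "j \<in> I" "j \<noteq> i" using other_part assms(1) by blast
  interpret P: clique_separation G S "D i" using assms(1) by (rule clique_separation)
  interpret Q: clique_separation G S "D j" using j(1) by (rule clique_separation)
  have "arcs_ends G `` {s} \<inter> D j \<noteq> {}" using Q.ex_nbr_in_D card_S_le assms(2) by blast
  then have "arcs_ends G `` {s} \<inter> (D i \<union> S) \<subset> arcs_ends G `` {s}"
    using parts_disjoint[OF assms(1) j(1)] j(2) Q.D_verts by blast
  then show ?thesis using deg_induce[OF P.W_verts, of s] deg_eq_card finite_nbrs assms(2)
    by (simp add: psubset_card_mono)
qed

text \<open>With one end in \<open>D i\<close> all paths of \<open>G\<close> survive and degrees can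
  only drop. With both ends in \<open>S\<close>, the end of smaller degree in \<open>G\<close> is
  saturated, and its edges inside \<open>H i\<close> still start disjoint paths there.\<close>

lemma ideally_connected_H:
  assumes ideal: "ideally_connected G" and i: "i \<in> I"
  shows "ideally_connected (H i)"
proof -
  interpret P: clique_separation G S "D i" using i by (rule clique_separation)
  have lc: "local_connectivity G u v = min (deg G u) (deg G v)"
    if "u \<in> D i \<union> S" "v \<in> D i \<union> S" "u \<noteq> v" for u v
    using ideal that P.W_verts unfolding ideally_connected_def by blast
  have deg: "deg (H i) u \<le> deg G u" if "u \<in> D i \<union> S" for u using deg_H_le_deg[OF i that] .
  have D: "min (deg (H i) u) (deg (H i) v) \<le> local_connectivity (H i) u v"
    if "u \<in> D i" "v \<in> D i \<union> S" "u \<noteq> v" for u v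
    using P.local_connectivity_le_H[OF that] lc[of u v] deg[of u] deg[of v] that by simp
  have S: "min (deg (H i) u) (deg (H i) v) \<le> local_connectivity (H i) u v"
    if "u \<in> S" "v \<in> S" "u \<noteq> v" "deg G u \<le> deg G v" for u v
    using P.deg_H_le_local_connectivity[of u v] lc[of u v] that by simp
  show ?thesis unfolding P.H.ideally_connected_iff
  proof (intro ballI impI)
    fix u v assume uv: "u \<in> verts (H i)" "v \<in> verts (H i)" "u \<noteq> v"
    then consider "u \<in> D i" | "v \<in> D i" | "u \<in> S" "v \<in> S" "deg G u \<le> deg G v"
      | "u \<in> S" "v \<in> S" "deg G v \<le> deg G u" by fastforce
    then show "min (deg (H i) u) (deg (H i) v) \<le> local_connectivity (H i) u v"
      using D[of u v] D[of v u] S[of u v] S[of v u] uv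
        P.H.local_connectivity_commute[of u v] by cases (simp_all add: min.commute)
  qed
qed

text \<open>Saturation at \<open>s\<close> leaves \<open>deg (H i) s\<close> disjoint paths in
  \<open>H i\<close>, and these cannot exceed the degree at their other end.\<close>

lemma deg_H_mono:
  assumes "ideally_connected G" "i \<in> I" "s \<in> S" "s' \<in> S" "s \<noteq> s'" "deg G s \<le> deg G s'"
  shows "deg (H i) s \<le> deg (H i) s'"
proof -
  interpret P: clique_separation G S "D i" using assms(2) by (rule clique_separation)
  have "local_connectivity G s s' = deg G s"
    using assms S_verts unfolding ideally_connected_def by (metis min.absorb1 subsetD)
  then show ?thesis
    using P.deg_H_le_local_connectivity[of s s'] P.H.local_connectivity_le_deg[of s s'] assms by simp
qed

text \<open>The minimum of \<open>deg G u\<close> and \<open>deg G s\<close> is at most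
  \<open>deg (H i) s\<close>, which is less than \<open>deg G s\<close>; hence the minimum is
  \<open>deg G u\<close>, the degree of \<open>u\<close> in \<open>H i\<close>.\<close>

lemma deg_D_le_deg_S:
  assumes "ideally_connected G" "i \<in> I" "u \<in> D i" "s \<in> S"
  shows "deg (H i) u \<le> deg (H i) s"
proof -
  interpret P: clique_separation G S "D i" using assms(2) by (rule clique_separation)
  have us: "u \<noteq> s" "u \<in> verts G" "s \<in> verts G" using assms P.D_verts S_verts by auto
  then have "min (deg G u) (deg G s) = local_connectivity G u s"
    using assms(1) unfolding ideally_connected_def by simp
  also have "\<dots> \<le> local_connectivity (H i) u s" using P.local_connectivity_le_H us assms by simp
  also have "\<dots> \<le> deg (H i) s" using P.H.local_connectivity_le_deg[OF us(1)] by simp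
  finally show ?thesis using deg_H_less_deg[OF assms(2,4)] P.deg_H_D[OF assms(3)] by simp
qed

text \<open>Between different parts only \<open>card S\<close> disjoint paths exist, fewer than both
  degrees.\<close>

lemma unique_large_part:
  assumes "ideally_connected G" "i \<in> I" "j \<in> I" "u \<in> D i" "card S < deg G u" "v \<in> D j" "card S < deg G v"
  shows "i = j"
proof (rule ccontr)
  assume "i \<noteq> j"
  interpret P: clique_separation G S "D i" using assms(2) by (rule clique_separation)
  interpret Q: clique_separation G S "D j" using assms(3) by (rule clique_separation)
  have "v \<in> verts G - (D i \<union> S)" "u \<in> verts G"
    using assms parts_disjoint \<open>i \<noteq> j\<close> P.D_verts Q.D_verts by blast+
  moreover have "u \<noteq> v" using calculation assms(4) by blast
  ultimately have "min (deg G u) (deg G v) \<le> card S"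
    using P.local_connectivity_across_le[OF assms(4)] assms(1) unfolding ideally_connected_def
    by (metis DiffD1)
  then show False using assms by simp
qed

section \<open>Sufficiency of the conditions\<close>

lemma local_connectivity_clique:
  assumes ss: "s \<in> S" "s' \<in> S" "s \<noteq> s'"
    and sat: "\<And>i. i \<in> I \<Longrightarrow> deg (H i) s \<le> local_connectivity (H i) s s'"
  shows "deg G s \<le> local_connectivity G s s'"
proof -
  have "\<exists>P. P \<subseteq> paths_between G s s' \<and> pairwise internally_disjoint P \<and>
      (\<forall>p\<in>P. internal_verts p \<subseteq> D i) \<and> arcs_ends G `` {s} \<inter> D i \<subseteq> (\<lambda>p. hd (tl p)) ` P"
    if "i \<in> I" for i
  proof -
    interpret P: clique_separation G S "D i" using that by (rule clique_separation)
    show ?thesis using P.paths_through_D[OF ss sat[OF that]] by metis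
  qed
  then obtain P where P: "\<And>i. i \<in> I \<Longrightarrow> P i \<subseteq> paths_between G s s'"
    "\<And>i. i \<in> I \<Longrightarrow> pairwise internally_disjoint (P i)"
    "\<And>i p. i \<in> I \<Longrightarrow> p \<in> P i \<Longrightarrow> internal_verts p \<subseteq> D i"
    "\<And>i. i \<in> I \<Longrightarrow> arcs_ends G `` {s} \<inter> D i \<subseteq> (\<lambda>p. hd (tl p)) ` P i" by metis
  \<comment> \<open>For \<open>w = s'\<close> the path is the edge itself; in both cases
    \<open>w\<close> is its second vertex.\<close>
  define r where "r w = (if w = s' then [s, s'] else [s, w, s'])" for w
  define Q where "Q = (\<Union>i\<in>I. P i) \<union> r ` (S - {s})"
  have r: "r w \<in> paths_between G s s'" "internal_verts (r w) = {w} - {s'}" "hd (tl (r w)) = w"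
    if "w \<in> S - {s}" for w
    using that ss clique S_verts
    by (auto simp: r_def paths_between_def vpath_def vwalk_def internal_verts_def)
  have Q_paths: "Q \<subseteq> paths_between G s s'" using P(1) r(1) unfolding Q_def by blast
  have DS: "D i \<inter> S = {}" if "i \<in> I" for i using parts that by blast
  have "internal_verts p \<inter> internal_verts q = {}" if "p \<in> Q" "q \<in> Q" "p \<noteq> q" for p q
  proof -
    have PP: ?thesis if "i \<in> I" "j \<in> I" "p \<in> P i" "q \<in> P j" for i j
    proof (cases "i = j")
      case True
      then show ?thesis
        using that P(2)[of i] \<open>p \<noteq> q\<close> unfolding pairwise_def internally_disjoint_def by blast
    next
      case False
      then show ?thesis using P(3) that parts_disjoint by blast
    qed
    have PR: "internal_verts p' \<inter> internal_verts (r w) = {}"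
      if "i \<in> I" "p' \<in> P i" "w \<in> S - {s}" for i p' w
      using P(3)[OF that(1,2)] r(2)[OF that(3)] DS[OF that(1)] that(3) by auto
    have RR: ?thesis if "w \<in> S - {s}" "w' \<in> S - {s}" "p = r w" "q = r w'" for w w'
      using r(2)[OF that(1)] r(2)[OF that(2)] that \<open>p \<noteq> q\<close> by auto
    from \<open>p \<in> Q\<close> \<open>q \<in> Q\<close> consider i j where "i \<in> I" "j \<in> I" "p \<in> P i" "q \<in> P j"
      | i w where "i \<in> I" "p \<in> P i" "w \<in> S - {s}" "q = r w"
      | i w where "i \<in> I" "q \<in> P i" "w \<in> S - {s}" "p = r w"
      | w w' where "w \<in> S - {s}" "w' \<in> S - {s}" "p = r w" "q = r w'"
      unfolding Q_def by blast
    then show ?thesis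
    proof cases
      case 3
      then show ?thesis using PR by (simp add: Int_commute)
    qed (use PP PR RR in blast)+
  qed
  then have Q_disj: "pairwise internally_disjoint Q"
    unfolding pairwise_def internally_disjoint_def by blast
  \<comment> \<open>The family is counted through its second vertices: they exhaust the neighbours
    of \<open>s\<close>, which gives at least \<open>deg G s\<close> paths.\<close>
  have nbrs: "arcs_ends G `` {s} \<subseteq> (\<lambda>p. hd (tl p)) ` Q"
  proof
    fix w assume w: "w \<in> arcs_ends G `` {s}"
    then have "w \<in> verts G" "w \<noteq> s" using adj_in_verts adj_not_same by auto
    then consider i where "i \<in> I" "w \<in> D i" | "w \<in> S - {s}" using parts by blast
    then show "w \<in> (\<lambda>p. hd (tl p)) ` Q"
    proof cases
      case 1
      then show ?thesis using P(4)[of i] w unfolding Q_def by blast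
    next
      case 2
      then have "r w \<in> Q" unfolding Q_def by blast
      then show ?thesis using r(3)[OF 2] by (metis imageI)
    qed
  qed
  have fin: "finite Q" using Q_paths finite_paths_between finite_subset by blast
  have "deg G s \<le> card ((\<lambda>p. hd (tl p)) ` Q)"
    unfolding deg_eq_card using nbrs fin by (intro card_mono) auto
  also have "\<dots> \<le> card Q" using fin by (rule card_image_le)
  also have "\<dots> \<le> local_connectivity G s s'" using Q_paths Q_disj by (rule local_connectivity_ge)
  finally show ?thesis .
qed

text \<open>The cases are two vertices outside \<open>S\<close>, one in \<open>S\<close>, and both
  in \<open>S\<close>.\<close>

lemma ideally_connectedI:
  assumes ideal: "\<And>i. i \<in> I \<Longrightarrow> ideally_connected (H i)"
    and large: "\<And>i j u v. i \<in> I \<Longrightarrow> j \<in> I \<Longrightarrow> u \<in> D i \<Longrightarrow> card S < deg G u \<Longrightarrow> v \<in> D j \<Longrightarrow> card S < deg G v \<Longrightarrow> i = j"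
    and large_le: "\<And>i u s. i \<in> I \<Longrightarrow> u \<in> D i \<Longrightarrow> card S < deg G u \<Longrightarrow> s \<in> S \<Longrightarrow> deg (H i) u \<le> deg (H i) s"
    and mono: "\<And>i s s'. i \<in> I \<Longrightarrow> s \<in> S \<Longrightarrow> s' \<in> S \<Longrightarrow> s \<noteq> s' \<Longrightarrow> deg G s \<le> deg G s' \<Longrightarrow>
      deg (H i) s \<le> deg (H i) s'"
  shows "ideally_connected G"
proof -
  let ?ok = "\<lambda>u v. min (deg G u) (deg G v) \<le> local_connectivity G u v"
  have lc: "min (deg (H i) u) (deg (H i) v) \<le> local_connectivity (H i) u v"
    "local_connectivity (H i) u v \<le> local_connectivity G u v"
    if "i \<in> I" "u \<in> D i \<union> S" "v \<in> D i \<union> S" "u \<noteq> v" for i u v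
  proof -
    interpret P: clique_separation G S "D i" using that(1) by (rule clique_separation)
    show "min (deg (H i) u) (deg (H i) v) \<le> local_connectivity (H i) u v"
      using ideal that P.H.ideally_connected_iff by simp
    show "local_connectivity (H i) u v \<le> local_connectivity G u v"
      by (rule P.local_connectivity_H_le)
  qed
  \<comment> \<open>Within one part, degrees and paths are those of \<open>H i\<close>. Across
    parts, Menger's theorem gives \<open>card S\<close> paths, and by \<open>large\<close> one of
    the two degrees is at most \<open>card S\<close>.\<close>
  have DD: "?ok u v" if i: "i \<in> I" "j \<in> I" "u \<in> D i" "v \<in> D j" "u \<noteq> v" for i j u v
  proof -
    interpret P: clique_separation G S "D i" using i(1) by (rule clique_separation)
    interpret Q: clique_separation G S "D j" using i(2) by (rule clique_separation)
    show ?thesis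
    proof (cases "i = j")
      case True
      then show ?thesis using lc[of i u v] P.deg_H_D[of u] P.deg_H_D[of v] i by simp
    next
      case False
      have "\<not> u \<rightarrow> v" using False P.D_closed[OF i(3)] i parts_disjoint Q.D_verts by blast
      then have "card S \<le> local_connectivity G u v"
        using le_local_connectivity_nonadjacent[of u v] card_S_le i P.D_verts Q.D_verts by blast
      then show ?thesis using large[OF i(1,2,3) _ i(4)] False by (meson le_trans linorder_not_le min.coboundedI1 min.coboundedI2)
    qed
  qed
  \<comment> \<open>In \<open>H i\<close> the smaller degree is that of \<open>u\<close>: by
    \<open>large_le\<close> if it exceeds \<open>card S\<close>, and otherwise because
    \<open>s\<close> has degree at least \<open>card S\<close> there. It is also the degree of
    \<open>u\<close> in \<open>G\<close>.\<close>
  have DS: "?ok u s" if i: "i \<in> I" "u \<in> D i" "s \<in> S" for i u s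
  proof -
    interpret P: clique_separation G S "D i" using i(1) by (rule clique_separation)
    have "deg (H i) u \<le> deg (H i) s"
    proof (cases "card S < deg G u")
      case True
      then show ?thesis using large_le i by blast
    next
      case False
      then show ?thesis using P.card_S_le_deg_H[OF card_S_le i(3)] P.deg_H_D[OF i(2)] by simp
    qed
    moreover have "u \<noteq> s" using i P.D_verts by blast
    ultimately show ?thesis using lc[of i u s] i P.deg_H_D[OF i(2)] by simp
  qed
  \<comment> \<open>By \<open>mono\<close> the vertex \<open>s\<close> has the smaller degree in
    every \<open>H i\<close> as well, so ideal connectedness of \<open>H i\<close> saturates it
    there.\<close>
  have SS: "?ok s s'" if s: "s \<in> S" "s' \<in> S" "s \<noteq> s'" "deg G s \<le> deg G s'" for s s'
    using local_connectivity_clique[OF s(1-3)] lc(1)[of _ s s'] mono[of _ s s'] s by (simp add: min.absorb1)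
  show ?thesis unfolding ideally_connected_iff
  proof (intro ballI impI)
    fix u v assume uv: "u \<in> verts G" "v \<in> verts G" "u \<noteq> v"
    have "u \<in> S \<or> (\<exists>i\<in>I. u \<in> D i)" "v \<in> S \<or> (\<exists>i\<in>I. v \<in> D i)" using uv parts by blast+
    then consider i j where "i \<in> I" "j \<in> I" "u \<in> D i" "v \<in> D j"
      | i where "i \<in> I" "u \<in> D i" "v \<in> S" | i where "i \<in> I" "v \<in> D i" "u \<in> S"
      | "u \<in> S" "v \<in> S" "deg G u \<le> deg G v" | "u \<in> S" "v \<in> S" "deg G v \<le> deg G u"
      using le_cases by metis
    then show "?ok u v"
      using DD[of _ _ u v] DS[of _ u v] DS[of _ v u] SS[of u v] SS[of v u] uv(3)
        local_connectivity_commute[of u v] by cases (simp_all add: min.commute)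
  qed
qed

end

section \<open>Reading the parts off the components of \<open>G - S\<close>\<close>

theorem theorem3p1:
  fixes G :: "('a, 'b) pre_digraph" and S :: "'a set" and t m :: nat
    and H C :: "nat \<Rightarrow> ('a, 'b) pre_digraph"
  assumes "graph G"
    and "kappa_clique_cut G S"
    and "t = card S"
    and "bij_betw H {1..m} (S_subgraphs G S)"
    and "\<And>i. i \<in> {1..m} \<Longrightarrow> C i = del_verts (H i) S"
  shows "ideally_connected G \<longleftrightarrow>
    (\<forall>K \<in> S_subgraphs G S. ideally_connected K \<and> t_connected t K) \<and>
    ((\<forall>i\<in>{1..m}. \<forall>j\<in>{1..m}.
        (\<exists>u\<in>verts (C i). t < deg G u) \<and> (\<exists>u\<in>verts (C j). t < deg G u) \<longrightarrow> i = j) \<and>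
     (\<forall>j\<in>{1..m}. (\<exists>u\<in>verts (C j). t < deg G u) \<longrightarrow>
        (\<forall>u\<in>verts (H j) - S. \<forall>s\<in>S. deg (H j) u \<le> deg (H j) s \<and> deg (H j) s < deg G s))) \<and>
    (\<forall>s\<^sub>1\<in>S. \<forall>s\<^sub>2\<in>S. s\<^sub>1 \<noteq> s\<^sub>2 \<and> deg G s\<^sub>1 \<le> deg G s\<^sub>2 \<longrightarrow>
        (\<forall>i\<in>{1..m}. deg (H i) s\<^sub>1 \<le> deg (H i) s\<^sub>2))"
proof -
  interpret graph G by fact
  let ?I = "{1..m}" and ?K = "del_verts G S"
  interpret K: graph ?K unfolding del_verts_def by (rule graph_induce) blast
  have cut: "vertex_cutset G S" and "\<not> complete G" and clique: "\<And>s s'. s \<in> S \<Longrightarrow> s' \<in> S \<Longrightarrow> s \<noteq> s' \<Longrightarrow> s \<rightarrow>\<^bsub>G\<^esub> s'"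
    and "card S = vertex_connectivity G"
    using assms(2) unfolding kappa_clique_cut_def by blast+
  then have card_S_le: "\<And>X. vertex_cutset G X \<Longrightarrow> card S \<le> card X"
    using le_vertex_connectivity_iff by (metis order_refl)
  have K_verts: "verts ?K = verts G - S" by (simp add: del_verts_def)
  have img: "H ` ?I = S_subgraphs G S" and inj: "inj_on H ?I" using assms(4) unfolding bij_betw_def by auto
  \<comment> \<open>The enumeration \<open>H\<close> lists subgraphs that include \<open>S\<close>;
    a component \<open>c i\<close> behind each of them is recovered first.\<close>
  have "\<exists>c. c \<in> K.sccs \<and> H i = G \<restriction> (verts c \<union> S)" if "i \<in> ?I" for i
    using that img unfolding S_subgraphs_def K.components_eq_sccs by auto
  then obtain c where c: "\<And>i. i \<in> ?I \<Longrightarrow> c i \<in> K.sccs" "\<And>i. i \<in> ?I \<Longrightarrow> H i = G \<restriction> (verts (c i) \<union> S)"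
    by metis
  define D where "D i = verts (c i)" for i
  have H: "H i = G \<restriction> (D i \<union> S)" if "i \<in> ?I" for i using c(2) that by (simp add: D_def)
  have D_verts: "D i \<subseteq> verts G - S" if "i \<in> ?I" for i
    using c(1)[OF that] K_verts K.in_sccs_imp_induced unfolding D_def by (metis induced_imp_subgraph subgraph_imp_subverts)
  \<comment> \<open>Components avoid \<open>S\<close>, so the vertex set of an
    \<open>S\<close>-subgraph determines its component; hence \<open>c\<close> reaches every
    component.\<close>
  have ex_part: "\<exists>i\<in>?I. d = c i" if d: "d \<in> K.sccs" for d
  proof -
    have "G \<restriction> (verts d \<union> S) \<in> H ` ?I"
      unfolding img S_subgraphs_def K.components_eq_sccs using d by blast
    then obtain i where i: "i \<in> ?I" "G \<restriction> (verts d \<union> S) = G \<restriction> (D i \<union> S)" using H by auto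
    then have "verts d \<union> S = D i \<union> S" by (metis induce_subgraph_verts)
    moreover have "verts d \<subseteq> verts G - S"
      using d K_verts K.in_sccs_imp_induced by (metis induced_imp_subgraph subgraph_imp_subverts)
    ultimately have "verts d = verts (c i)" using D_verts[OF i(1)] unfolding D_def by blast
    then show ?thesis using K.in_sccs_subset_imp_eq[OF d c(1)[OF i(1)]] i(1) by blast
  qed
  interpret X: clique_decomposition G S ?I D
  proof
    show "S \<subseteq> verts G" using cut by (auto simp: vertex_cutset_def)
    show "(\<Union>i\<in>?I. D i) = verts G - S"
    proof
      show "verts G - S \<subseteq> (\<Union>i\<in>?I. D i)"
        using K.scc_for_vert_ex ex_part unfolding K_verts D_def by blast
    qed (use D_verts in blast)
    show "D i \<noteq> {}" if "i \<in> ?I" for i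
      using c(1)[OF that] unfolding D_def K.sccs_def strongly_connected_def by blast
    show "D i \<inter> D j = {}" if ij: "i \<in> ?I" "j \<in> ?I" "i \<noteq> j" for i j
    proof -
      have "H i \<noteq> H j" using inj ij unfolding inj_on_def by blast
      then have "c i \<noteq> c j" using c(2) ij by metis
      then show ?thesis using K.scc_disj c(1) ij unfolding D_def by blast
    qed
    show "y \<in> D i \<union> S" if i: "i \<in> ?I" "x \<in> D i" "x \<rightarrow>\<^bsub>G\<^esub> y" for i x y
    proof (cases "y \<in> S")
      case False
      then have "x \<rightarrow>\<^bsub>?K\<^esub> y" using i D_verts adj_in_verts[OF i(3)]
        unfolding del_verts_def arcs_ends_induce by blast
      then show ?thesis using K.scc_closed c(1) i unfolding D_def by blast
    qed simp
    show "\<exists>j\<in>?I. j \<noteq> i" if i: "i \<in> ?I" for i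
    proof (rule ccontr)
      assume only: "\<not> (\<exists>j\<in>?I. j \<noteq> i)"
      \<comment> \<open>If \<open>i\<close> were the only index, its component would be all of
        \<open>G - S\<close>, which would then be connected.\<close>
      have "verts ?K \<subseteq> verts (c i)"
      proof
        fix x assume "x \<in> verts ?K"
        then obtain d where d: "d \<in> K.sccs" "x \<in> verts d" using K.scc_for_vert_ex by blast
        obtain j where "j \<in> ?I" "d = c j" using ex_part[OF d(1)] by blast
        moreover then have "j = i" using only by blast
        ultimately show "x \<in> verts (c i)" using d(2) by simp
      qed
      moreover have ind: "induced_subgraph (c i) ?K" using c(1)[OF i] by (rule K.in_sccs_imp_induced)
      moreover then have "verts (c i) \<subseteq> verts ?K" by (intro subgraph_imp_subverts induced_imp_subgraph)
      ultimately have "c i = ?K" using induced_eq_verts_imp_eq[OF ind K.induced_subgraph_refl] by blast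
      then have "strongly_connected ?K" using c(1)[OF i] unfolding K.sccs_def by auto
      then show False using cut K.connected_iff_strongly_connected unfolding vertex_cutset_def by blast
    qed
  qed (use clique card_S_le in blast)+
  have C: "verts (C i) = D i" if "i \<in> ?I" for i
    using assms(5)[OF that] H[OF that] D_verts[OF that] by (auto simp: del_verts_def)
  have HD: "verts (H i) - S = D i" if "i \<in> ?I" for i
    using H[OF that] D_verts[OF that] by auto
  have t_conn: "t_connected t K" if K: "K \<in> S_subgraphs G S" for K
  proof -
    obtain i where i: "i \<in> ?I" "K = H i" using K unfolding img[symmetric] by blast
    interpret P: clique_separation G S "D i" using i(1) by (rule X.clique_separation)
    show ?thesis using P.t_connected_H card_S_le i H assms(3) by simp
  qed
  show ?thesis (is "?ideal \<longleftrightarrow> ?one \<and> (?two_a \<and> ?two_b) \<and> ?three")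
  proof
    assume ideal: ?ideal
    have ?one using X.ideally_connected_H[OF ideal] H t_conn unfolding img[symmetric] by auto
    moreover have ?two_a using X.unique_large_part[OF ideal] C assms(3) by blast
    moreover have ?two_b
      using X.deg_D_le_deg_S[OF ideal] X.deg_H_less_deg HD H by auto
    moreover have ?three using X.deg_H_mono[OF ideal] H by auto
    ultimately show "?one \<and> (?two_a \<and> ?two_b) \<and> ?three" by blast
  next
    assume conds: "?one \<and> (?two_a \<and> ?two_b) \<and> ?three"
    note one = conds[THEN conjunct1]
      and two_a = conds[THEN conjunct2, THEN conjunct1, THEN conjunct1]
      and two_b = conds[THEN conjunct2, THEN conjunct1, THEN conjunct2]
      and three = conds[THEN conjunct2, THEN conjunct2]
    show ?ideal
    proof (rule X.ideally_connectedI)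
      fix i assume i: "i \<in> ?I"
      have "H i \<in> S_subgraphs G S" using i unfolding img[symmetric] by blast
      then show "ideally_connected (G \<restriction> (D i \<union> S))" using one unfolding H[OF i, symmetric] by blast
      show "deg (G \<restriction> (D i \<union> S)) u \<le> deg (G \<restriction> (D i \<union> S)) s"
        if u: "u \<in> D i" "card S < deg G u" "s \<in> S" for u s
      proof -
        have "\<exists>u\<in>verts (C i). t < deg G u" using u C[OF i] assms(3) by blast
        moreover have "u \<in> verts (H i) - S" using u HD[OF i] by blast
        ultimately show ?thesis using two_b i u(3) unfolding H[OF i, symmetric] by blast
      qed
      show "deg (G \<restriction> (D i \<union> S)) s \<le> deg (G \<restriction> (D i \<union> S)) s'"
        if "s \<in> S" "s' \<in> S" "s \<noteq> s'" "deg G s \<le> deg G s'" for s s'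
        using three that i unfolding H[OF i, symmetric] by blast
    next
      fix i j u v
      assume "i \<in> ?I" "j \<in> ?I" "u \<in> D i" "card S < deg G u" "v \<in> D j" "card S < deg G v"
      then show "i = j" using two_a C assms(3) by blast
    qed
  qed
qed

end
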